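(* Let $N$ be a finitely generated torsion-free nilpotent group of nilpotency class $c$, let $H\le N$ be a subgroup of finite index, and let $\phi:H\to N$ be a homomorphism with induced morphisms $\phi_i:H_iN_{i+1}/N_{i+1}\to N_i/N_{i+1}$ and associated matrices $M_i\in\mathbb Q^{k_i\times k_i}$ ($1\le i\le c$). Then \[R(\phi)=[N:H]\cdot\big|\det(I_{\sum k_i}-M)\big|_\infty,\qquad M=\mathrm{diag}(M_1,M_2,\dots,M_c)\ \text{(block diagonal)}.\]
   Context: The lower central series of a group $K$ is $\gamma_1(K)=K$, $\gamma_{i+1}(K)=[K,\gamma_i(K)]$. For $L\le K$, the isolator is $\sqrt[K]{L}=\{x\in K:\exists m>0,\ x^m\in L\}$. Put $N_i=\sqrt[N]{\gamma_i(N)}$ and $H_i=\sqrt[H]{\gamma_i(H)}$, with $N_{c+1}=1$. Each $N_i/N_{i+1}$ is free abelian of some rank $k_i$. Fix a Malcev basis: elements $a_{i,j}\in N_i$ ($1\le j\le k_i$) whose cosets form a free basis of $N_i/N_{i+1}$. This identifies $N_i/N_{i+1}$ with $\mathbb Z^{k_i}$ via $a_{i,j}N_{i+1}\mapsto e_j$. The map $\phi_i:H_iN_{i+1}/N_{i+1}\to N_i/N_{i+1}$, $hN_{i+1}\mapsto\phi(h)N_{i+1}$ for $h\in H_i$, is a well-defined homomorphism. Under the identification, $H_iN_{i+1}/N_{i+1}$ is a finite-index subgroup $B_i\mathbb Z^{k_i}$ (with $B_i\in\mathbb Z^{k_i\times k_i}$, $\det B_i\neq0$), and $M_i\in\mathbb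 Q^{k_i\times k_i}$ is the unique matrix with $\phi_i(z)=M_iz$. Generalized twisted conjugacy: for a group $K$, a finite-index subgroup $L\le K$ and a homomorphism $\phi:L\to K$, set $\alpha\sim_\phi\beta\iff\exists\gamma\in L:\ \alpha=\gamma\beta\phi(\gamma^{-1})$. $R(\phi)\in\mathbb Z_{>0}\cup\{\infty\}$ is the number of classes. $|a|_\infty=|a|$ for $a\neq 0$ and $|0|_\infty=\infty$. *)

theory Defs
  imports "HOL-Algebra.Coset" "HOL-Algebra.Generated_Groups"
    "Jordan_Normal_Form.Determinant" "HOL-Library.Extended_Real"
begin

definition comm_subgroup :: "('a, 'b) monoid_scheme \<Rightarrow> 'a set \<Rightarrow> 'a set \<Rightarrow> 'a set" where
  "comm_subgroup G A B = generate G
     {x \<otimes>\<^bsub>G\<^esub> y \<otimes>\<^bsub>G\<^esub> inv\<^bsub>G\<^esub> x \<otimes>\<^bsub>G\<^esub> inv\<^bsub>G\<^esub> y | x y. x \<in> A \<and> y \<in> B}"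

text \<open>lcs0 G n is gamma_(n+1)(G).\<close>
fun lcs0 :: "('a, 'b) monoid_scheme \<Rightarrow> nat \<Rightarrow> 'a set" where
  "lcs0 G 0 = carrier G"
| "lcs0 G (Suc n) = comm_subgroup G (carrier G) (lcs0 G n)"

text \<open>Lower central series gamma_i(G), indexed from i = 1 (gamma_1(G) = G).\<close>
definition lcs :: "('a, 'b) monoid_scheme \<Rightarrow> nat \<Rightarrow> 'a set" where
  "lcs G i = lcs0 G (i - 1)"

definition isolator :: "('a, 'b) monoid_scheme \<Rightarrow> 'a set \<Rightarrow> 'a set" where
  "isolator G L = {x \<in> carrier G. \<exists>m::nat. m > 0 \<and> x [^]\<^bsub>G\<^esub> m \<in> L}"

definition finitely_generated_group :: "('a, 'b) monoid_scheme \<Rightarrow> bool" where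
  "finitely_generated_group G \<longleftrightarrow>
     (\<exists>S. finite S \<and> S \<subseteq> carrier G \<and> generate G S = carrier G)"

definition torsion_free :: "('a, 'b) monoid_scheme \<Rightarrow> bool" where
  "torsion_free G \<longleftrightarrow>
     (\<forall>x \<in> carrier G. \<forall>m::nat. m > 0 \<longrightarrow> x [^]\<^bsub>G\<^esub> m = \<one>\<^bsub>G\<^esub> \<longrightarrow> x = \<one>\<^bsub>G\<^esub>)"

definition nilpotent_class :: "('a, 'b) monoid_scheme \<Rightarrow> nat \<Rightarrow> bool" where
  "nilpotent_class G c \<longleftrightarrow>
     lcs G (c + 1) = {\<one>\<^bsub>G\<^esub>} \<and> (\<forall>c' < c. lcs G (c' + 1) \<noteq> {\<one>\<^bsub>G\<^esub>})"

fun gprod :: "('a, 'b) monoid_scheme \<Rightarrow> (nat \<Rightarrow> 'a) \<Rightarrow> nat \<Rightarrow> 'a" where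
  "gprod G f 0 = \<one>\<^bsub>G\<^esub>"
| "gprod G f (Suc n) = gprod G f n \<otimes>\<^bsub>G\<^esub> f n"

definition twisted_classes :: "('a, 'b) monoid_scheme \<Rightarrow> 'a set \<Rightarrow> ('a \<Rightarrow> 'a) \<Rightarrow> 'a set set" where
  "twisted_classes G L \<phi> =
     (\<lambda>\<beta>. {\<gamma> \<otimes>\<^bsub>G\<^esub> \<beta> \<otimes>\<^bsub>G\<^esub> inv\<^bsub>G\<^esub> (\<phi> \<gamma>) | \<gamma>. \<gamma> \<in> L}) ` carrier G"

definition reidemeister :: "('a, 'b) monoid_scheme \<Rightarrow> 'a set \<Rightarrow> ('a \<Rightarrow> 'a) \<Rightarrow> enat" where
  "reidemeister G L \<phi> =
     (if finite (twisted_classes G L \<phi>) then enat (card (twisted_classes G L \<phi>)) else \<infinity>)"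

definition abs_inf :: "real \<Rightarrow> ereal" where
  "abs_inf a = (if a = 0 then \<infinity> else ereal \<bar>a\<bar>)"

end

theory Submission
  imports Defs "HOL-Library.Function_Algebras"
begin

text \<open>
  Let \<open>H\<close> act on \<open>N\<close> by \<open>x \<mapsto> h x \<phi>(h)\<^sup>-\<^sup>1\<close>; then \<open>R(\<phi>)\<close> is the number of orbits, and for the trivial
  homomorphism it is \<open>[N : H]\<close>. Count the orbits modulo \<open>N\<^sub>i\<close> for increasing \<open>i\<close>.
  Since \<open>N\<^sub>i/N\<^sub>i\<^sub>+\<^sub>1\<close> is central in \<open>N/N\<^sub>i\<^sub>+\<^sub>1\<close>, as long as \<open>det (I - M\<^sub>l) \<noteq> 0\<close> for \<open>l < i\<close> the stabilizer of every coset
  \<open>x N\<^sub>i\<close> is \<open>H \<inter> N\<^sub>i\<close>, which acts on \<open>x N\<^sub>i/N\<^sub>i\<^sub>+\<^sub>1\<close> by translations by \<open>(I - M\<^sub>i) L\<^sub>i\<close>, where \<open>L\<^sub>i\<close> is the lattice given by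
  \<open>H \<inter> N\<^sub>i\<close>. So each orbit modulo \<open>N\<^sub>i\<close> splits into \<open>[\<int>\<^sup>k : (I - M\<^sub>i) L\<^sub>i] = |det (I - M\<^sub>i)| [\<int>\<^sup>k : L\<^sub>i]\<close> orbits
  modulo \<open>N\<^sub>i\<^sub>+\<^sub>1\<close>, infinitely many if the determinant vanishes. The factors \<open>[\<int>\<^sup>k : L\<^sub>i]\<close> are those of the trivial
  homomorphism, so their product is \<open>[N : H]\<close>.

  That the \<open>N\<^sub>i\<close> form a central series with \<open>H\<^sub>i = H \<inter> N\<^sub>i\<close> rests on one fact: if a nilpotent group \<open>K\<close> is generated by elements with
  a power in \<open>H\<close>, then every element of \<open>\<gamma>\<^sub>n(K)\<close> has a power in \<open>\<gamma>\<^sub>n(H)\<close>.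
\<close>

section \<open>Index of sublattices and determinants\<close>

lemma image_bij_betw_if_same_fibres:
  assumes "\<And>a b. a \<in> A \<Longrightarrow> b \<in> A \<Longrightarrow> p a = p b \<longleftrightarrow> q a = q b"
  obtains h where "bij_betw h (p ` A) (q ` A)"
proof
  let ?h = "\<lambda>c. q (inv_into A p c)"
  have *: "?h (p a) = q a" if "a \<in> A" for a
    by (metis assms f_inv_into_f imageI inv_into_into that)
  show "bij_betw ?h (p ` A) (q ` A)"
    unfolding bij_betw_def
  proof
    show "inj_on ?h (p ` A)"
      using * assms by (auto simp: inj_on_def)
    show "?h ` p ` A = q ` A"
      using * by (auto simp: image_image)
  qed
qed

text \<open>Quotients appear in this proof as images of coset maps or class maps, so two of them are
  compared by showing that the maps identify the same pairs. Finiteness is stated separately because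
  \<open>card\<close> sends infinite sets to 0.\<close>

lemma card_image_if_same_fibres:
  assumes "\<And>a b. a \<in> A \<Longrightarrow> b \<in> A \<Longrightarrow> p a = p b \<longleftrightarrow> q a = q b"
  shows "card (p ` A) = card (q ` A)" and "finite (p ` A) \<longleftrightarrow> finite (q ` A)"
  by (metis (no_types, lifting) assms bij_betw_finite bij_betw_same_card image_bij_betw_if_same_fibres)+

lemma finite_image_coarser:
  assumes "finite (g ` X)" "\<And>x y. x \<in> X \<Longrightarrow> y \<in> X \<Longrightarrow> g x = g y \<Longrightarrow> f x = f y"
  shows "finite (f ` X)"
proof -
  have "f ` X = (\<lambda>c. f (inv_into X g c)) ` (g ` X)"
    unfolding image_image
    by (rule image_cong[OF refl]) (metis f_inv_into_f imageI inv_into_into assms(2))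
  then show ?thesis using assms(1) by simp
qed

text \<open>By \<open>refine\<close>, the \<open>g\<close>-values over different
  \<open>f\<close>-values are disjoint, so counting them fibre by fibre gives a product.
  Multiplicativity of the index and the passage from one level of the filtration to the next are
  both instances.\<close>

lemma card_image_refinement:
  assumes fin: "finite (g ` X)"
    and refine: "\<And>x y. x \<in> X \<Longrightarrow> y \<in> X \<Longrightarrow> g x = g y \<Longrightarrow> f x = f y"
    and fibre: "\<And>x. x \<in> X \<Longrightarrow> card (g ` {y \<in> X. f y = f x}) = n"
  shows "card (g ` X) = n * card (f ` X)"
proof -
  have fin': "finite (f ` X)"
    using finite_image_coarser[OF fin refine] .
  have "g ` X = (\<Union>c\<in>f ` X. g ` {y \<in> X. f y = c})"
    by auto
  also have "card \<dots> = (\<Sum>c\<in>f ` X. card (g ` {y \<in> X. f y = c}))"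
  proof (rule card_UN_disjoint[OF fin'])
    show "\<forall>c\<in>f ` X. finite (g ` {y \<in> X. f y = c})"
      using fin by (auto intro: finite_subset[OF _ fin])
    show "\<forall>c\<in>f ` X. \<forall>d\<in>f ` X. c \<noteq> d \<longrightarrow> g ` {y \<in> X. f y = c} \<inter> g ` {y \<in> X. f y = d} = {}"
      using refine by blast
  qed
  also have "\<dots> = (\<Sum>c\<in>f ` X. n)"
    by (rule sum.cong) (use fibre in auto)
  finally show ?thesis by simp
qed

lemma finite_image_refinement:
  assumes "finite (f ` X)"
    and "\<And>x. x \<in> X \<Longrightarrow> finite (g ` {y \<in> X. f y = f x})"
  shows "finite (g ` X)"
proof -
  have "g ` X = (\<Union>c\<in>f ` X. g ` {y \<in> X. f y = c})"
    by auto
  moreover have "finite \<dots>"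
    using assms by (intro finite_UN_I) auto
  ultimately show ?thesis by simp
qed

section \<open>Additive subgroups and their cosets\<close>

definition add_subgroup :: "'a::ab_group_add set \<Rightarrow> bool" where
  "add_subgroup B \<longleftrightarrow> 0 \<in> B \<and> (\<forall>x\<in>B. \<forall>y\<in>B. x - y \<in> B)"

lemma add_subgroup_zero: "add_subgroup B \<Longrightarrow> 0 \<in> B"
  and add_subgroup_diff: "add_subgroup B \<Longrightarrow> x \<in> B \<Longrightarrow> y \<in> B \<Longrightarrow> x - y \<in> B"
  by (auto simp: add_subgroup_def)

lemma add_subgroup_uminus: "add_subgroup B \<Longrightarrow> x \<in> B \<Longrightarrow> - x \<in> B"
  using add_subgroup_diff[of B 0 x] add_subgroup_zero by auto

lemma add_subgroup_add: "add_subgroup B \<Longrightarrow> x \<in> B \<Longrightarrow> y \<in> B \<Longrightarrow> x + y \<in> B"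
  using add_subgroup_diff[of B x "- y"] add_subgroup_uminus by auto

lemma add_subgroup_sum:
  "add_subgroup B \<Longrightarrow> (\<And>i. i \<in> I \<Longrightarrow> f i \<in> B) \<Longrightarrow> sum f I \<in> B"
  by (induction I rule: infinite_finite_induct) (auto intro: add_subgroup_zero add_subgroup_add)

definition add_coset :: "'a::ab_group_add set \<Rightarrow> 'a \<Rightarrow> 'a set" where
  "add_coset B x = {y. y - x \<in> B}"

lemma add_coset_eq_iff:
  assumes "add_subgroup B"
  shows "add_coset B x = add_coset B y \<longleftrightarrow> x - y \<in> B"
proof
  assume "add_coset B x = add_coset B y"
  moreover have "x \<in> add_coset B x"
    using assms by (simp add: add_coset_def add_subgroup_zero)
  ultimately show "x - y \<in> B"
    by (simp add: add_coset_def)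
next
  assume *: "x - y \<in> B"
  have "z - x \<in> B \<longleftrightarrow> z - y \<in> B" for z
    using add_subgroup_add[OF assms _ *, of "z - x"] add_subgroup_diff[OF assms _ *, of "z - y"]
    by auto
  then show "add_coset B x = add_coset B y"
    by (auto simp: add_coset_def)
qed

text \<open>The elements of \<open>A\<close> in one coset of \<open>B\<close> form a translate of
  \<open>B\<close>, and a translate meets as many cosets of \<open>C\<close> as \<open>B\<close>
  itself does.\<close>

lemma card_add_coset_tower:
  assumes A: "add_subgroup A" and B: "add_subgroup B" and C: "add_subgroup C"
    and "C \<subseteq> B" "B \<subseteq> A" and fin: "finite (add_coset C ` A)"
  shows "card (add_coset C ` A) = card (add_coset C ` B) * card (add_coset B ` A)"
proof (rule card_image_refinement[OF fin])
  show "add_coset B x = add_coset B y" if "add_coset C x = add_coset C y" for x y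
    using that \<open>C \<subseteq> B\<close> by (auto simp: add_coset_eq_iff B C)
next
  fix x assume x: "x \<in> A"
  have "{y \<in> A. add_coset B y = add_coset B x} = (\<lambda>b. b + x) ` B"
  proof (intro equalityI subsetI)
    fix y assume "y \<in> {y \<in> A. add_coset B y = add_coset B x}"
    then show "y \<in> (\<lambda>b. b + x) ` B"
      by (intro image_eqI[of _ _ "y - x"]) (auto simp: add_coset_eq_iff B)
  qed (use x \<open>B \<subseteq> A\<close> in \<open>auto simp: add_coset_eq_iff B intro: add_subgroup_add[OF A]\<close>)
  then show "card (add_coset C ` {y \<in> A. add_coset B y = add_coset B x}) = card (add_coset C ` B)"
    by (simp add: image_image) (rule card_image_if_same_fibres, simp add: add_coset_eq_iff C)
qed

section \<open>Integer vectors and column operations\<close>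

text \<open>Integer vectors of length k are functions that vanish from k on: this gives a genuine
  additive group of which all \<open>\<int>\<^sup>k\<close> are nested subgroups.\<close>
definition zvec :: "nat \<Rightarrow> (nat \<Rightarrow> int) set" where
  "zvec k = {z. \<forall>j\<ge>k. z j = 0}"

text \<open>Matrix times vector for vectors encoded as functions. Being total, it is additive
  without side conditions on dimensions, and the default 0 keeps the result inside
  \<open>zvec\<close>.\<close>

definition mat_app :: "'a::comm_ring_1 mat \<Rightarrow> (nat \<Rightarrow> 'a) \<Rightarrow> nat \<Rightarrow> 'a" where
  "mat_app A z = (\<lambda>i. if i < dim_row A then \<Sum>j<dim_col A. A $$ (i, j) * z j else 0)"

lemma mat_app_diff: "mat_app A (x - y) = mat_app A x - mat_app A y"
  by (auto simp: mat_app_def fun_eq_iff right_diff_distrib sum_subtractf)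

lemma mat_app_zvec: "A \<in> carrier_mat k k \<Longrightarrow> mat_app A z \<in> zvec k"
  by (auto simp: mat_app_def zvec_def)

lemma add_subgroup_zvec: "add_subgroup (zvec k)"
  by (auto simp: add_subgroup_def zvec_def)

lemma zvec_mono: "z \<in> zvec k \<Longrightarrow> k \<le> l \<Longrightarrow> z \<in> zvec l"
  by (auto simp: zvec_def)

lemma add_subgroup_image:
  assumes A: "add_subgroup A" and diff: "\<And>x y. x \<in> A \<Longrightarrow> y \<in> A \<Longrightarrow> f (x - y) = f x - f y"
  shows "add_subgroup (f ` A)"
  unfolding add_subgroup_def
proof (intro conjI ballI)
  have "f 0 = 0"
    using diff[of 0 0] add_subgroup_zero[OF A] by simp
  then show "0 \<in> f ` A"
    using imageI[OF add_subgroup_zero[OF A], of f] by simp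
next
  fix u v assume "u \<in> f ` A" "v \<in> f ` A"
  then obtain x y where xy: "x \<in> A" "y \<in> A" "u = f x" "v = f y" by blast
  then have "u - v = f (x - y)" "x - y \<in> A"
    using diff add_subgroup_diff[OF A] by simp_all
  then show "u - v \<in> f ` A" by blast
qed

lemma add_subgroup_mat_app: "add_subgroup L \<Longrightarrow> add_subgroup (mat_app A ` L)"
  by (rule add_subgroup_image) (auto simp: mat_app_diff)

text \<open>Adding \<open>a\<close> times column \<open>l\<close> to column \<open>j\<close> has the
  same effect on the product as adding \<open>a * z j\<close> to coordinate \<open>l\<close> of the
  vector, so no new lattice points arise.\<close>

lemma mat_app_addcol_image_subset:
  assumes A: "A \<in> carrier_mat n n" and l: "l < n" "j < n" "j \<noteq> l"
  shows "mat_app (addcol a j l A) ` zvec n \<subseteq> mat_app A ` zvec n"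
proof
  fix y assume "y \<in> mat_app (addcol a j l A) ` zvec n"
  then obtain z where z: "z \<in> zvec n" "y = mat_app (addcol a j l A) z" by auto
  let ?z = "z(l := z l + a * z j)"
  have "(\<Sum>c<n. addcol a j l A $$ (i, c) * z c) = (\<Sum>c<n. A $$ (i, c) * ?z c)" if i: "i < n" for i
  proof -
    have "(\<Sum>c<n. addcol a j l A $$ (i, c) * z c)
        = (\<Sum>c<n. A $$ (i, c) * z c + (if c = j then a * A $$ (i, l) * z j else 0))"
      by (rule sum.cong) (use A i in \<open>auto simp: algebra_simps\<close>)
    also have "\<dots> = (\<Sum>c<n. A $$ (i, c) * z c) + a * A $$ (i, l) * z j"
      using l by (simp add: sum.distrib)
    also have "\<dots> = (\<Sum>c<n. A $$ (i, c) * z c + (if c = l then a * A $$ (i, l) * z j else 0))"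
      using l by (simp add: sum.distrib)
    also have "\<dots> = (\<Sum>c<n. A $$ (i, c) * ?z c)"
      by (rule sum.cong) (auto simp: algebra_simps)
    finally show ?thesis .
  qed
  then have "y = mat_app A ?z"
    using A z(2) by (auto simp: mat_app_def fun_eq_iff)
  moreover have "?z \<in> zvec n"
    using z l by (auto simp: zvec_def)
  ultimately show "y \<in> mat_app A ` zvec n" by blast
qed

lemma mat_app_addcol_image:
  assumes A: "A \<in> carrier_mat n n" and l: "l < n" "j < n" "j \<noteq> l"
  shows "mat_app (addcol a j l A) ` zvec n = mat_app A ` zvec n"
proof
  have "addcol (-a) j l (addcol a j l A) = A"
    using A l by (intro eq_matI) auto
  moreover have "addcol a j l A \<in> carrier_mat n n"
    using A by (intro carrier_matI) simp_all
  ultimately show "mat_app A ` zvec n \<subseteq> mat_app (addcol a j l A) ` zvec n"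
    using mat_app_addcol_image_subset[of "addcol a j l A" n l j "-a"] l by simp
qed (rule mat_app_addcol_image_subset[OF assms])

lemma mat_app_swapcols_image_subset:
  assumes A: "A \<in> carrier_mat n n" and l: "l < n" "j < n"
  shows "mat_app (swapcols j l A) ` zvec n \<subseteq> mat_app A ` zvec n"
proof
  fix y assume "y \<in> mat_app (swapcols j l A) ` zvec n"
  then obtain z where z: "z \<in> zvec n" "y = mat_app (swapcols j l A) z" by auto
  let ?p = "\<lambda>c. if c = j then l else if c = l then j else c"
  have "(\<Sum>c<n. swapcols j l A $$ (i, c) * z c) = (\<Sum>c<n. A $$ (i, c) * z (?p c))" if i: "i < n" for i
    by (rule sum.reindex_bij_witness[of _ ?p ?p]) (use A l i in auto)
  then have "y = mat_app A (\<lambda>c. z (?p c))"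
    using A z(2) by (auto simp: mat_app_def fun_eq_iff)
  moreover have "(\<lambda>c. z (?p c)) \<in> zvec n"
    using z l by (auto simp: zvec_def)
  ultimately show "y \<in> mat_app A ` zvec n" by blast
qed

lemma mat_app_swapcols_image:
  assumes A: "A \<in> carrier_mat n n" and l: "l < n" "j < n"
  shows "mat_app (swapcols j l A) ` zvec n = mat_app A ` zvec n"
proof
  have "swapcols j l (swapcols j l A) = A"
    using A l by (intro eq_matI) auto
  then show "mat_app A ` zvec n \<subseteq> mat_app (swapcols j l A) ` zvec n"
    using mat_app_swapcols_image_subset[of "swapcols j l A" n l j] A l by simp
qed (rule mat_app_swapcols_image_subset[OF assms])

section \<open>The index of an integer lattice is its determinant\<close>

lemma det_last_row:
  fixes A :: "'a::comm_ring_1 mat"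
  assumes A: "A \<in> carrier_mat (Suc k) (Suc k)" and row: "\<And>j. j < k \<Longrightarrow> A $$ (k, j) = 0"
  shows "det A = A $$ (k, k) * det (mat_delete A k k)"
proof -
  have "det A = (\<Sum>j<Suc k. A $$ (k, j) * cofactor A k j)"
    by (rule laplace_expansion_row[OF A]) simp
  also have "\<dots> = A $$ (k, k) * cofactor A k k"
    using row by simp
  finally show ?thesis
    by (simp add: cofactor_def)
qed

text \<open>The property carried through the column reduction. It depends on \<open>A\<close> only
  through its column lattice and the absolute value of its determinant, both invariant under column
  operations.\<close>

definition index_eq_det :: "nat \<Rightarrow> int mat \<Rightarrow> bool" where
  "index_eq_det k A \<longleftrightarrow> finite (add_coset (mat_app A ` zvec k) ` zvec k) \<and>
     int (card (add_coset (mat_app A ` zvec k) ` zvec k)) = \<bar>det A\<bar>"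

text \<open>Lattice vectors have last coordinate divisible by the corner entry \<open>g\<close>, so
  \<open>f\<close>, the last coordinate modulo \<open>g\<close>, is constant on cosets and takes as
  many values as the absolute value of \<open>g\<close>. Inside one fibre of \<open>f\<close> the
  last coordinate can be fixed; since \<open>g\<close> is nonzero, the remaining ambiguity is
  exactly the lattice of the smaller matrix.\<close>

lemma index_eq_det_last_row:
  assumes A: "A \<in> carrier_mat (Suc k) (Suc k)" and row: "\<And>j. j < k \<Longrightarrow> A $$ (k, j) = 0"
    and g0: "A $$ (k, k) \<noteq> 0" and IH: "index_eq_det k (mat_delete A k k)"
  shows "index_eq_det (Suc k) A"
proof -
  let ?A' = "mat_delete A k k"
  let ?L = "mat_app A ` zvec (Suc k)" and ?L' = "mat_app ?A' ` zvec k"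
  define g where "g = A $$ (k, k)"
  \<comment> \<open>The absolute value makes the residues run through
    \<open>{0..<\<bar>g\<bar>}\<close> for negative \<open>g\<close> as well.\<close>
  define f where "f x = x k mod \<bar>g\<bar>" for x :: "nat \<Rightarrow> int"
  have L: "add_subgroup ?L" and L': "add_subgroup ?L'"
    by (simp_all add: add_subgroup_mat_app add_subgroup_zvec)
  have app_k: "mat_app A z k = g * z k" for z
    using A row by (simp add: mat_app_def g_def)
  have app': "mat_app A z = mat_app ?A' z" if "z \<in> zvec k" for z
  proof
    fix i
    show "mat_app A z i = mat_app ?A' z i"
    proof (cases "i = k")
      case True
      then show ?thesis using app_k[of z] that A by (simp add: zvec_def) (simp add: mat_app_def)
    next
      case False
      then show ?thesis
        using that A by (auto simp: mat_app_def zvec_def mat_delete_def intro!: sum.cong)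
    qed
  qed
  have f_image: "f ` zvec (Suc k) = {0..<\<bar>g\<bar>}"
  proof (intro equalityI subsetI)
    fix t assume t: "t \<in> {0..<\<bar>g\<bar>}"
    show "t \<in> f ` zvec (Suc k)"
      by (rule image_eqI[of _ _ "\<lambda>i. if i = k then t else 0"]) (use t in \<open>auto simp: f_def zvec_def\<close>)
  qed (use g0 in \<open>auto simp: f_def g_def\<close>)
  have refine: "f x = f y" if "add_coset ?L x = add_coset ?L y" for x y
  proof -
    obtain z where "x - y = mat_app A z"
      using \<open>add_coset ?L x = add_coset ?L y\<close> by (auto simp: add_coset_eq_iff L)
    then have "x k - y k = g * z k"
      using app_k by (metis minus_apply)
    then show ?thesis
      unfolding f_def by (metis abs_dvd_iff dvd_triv_left mod_eq_dvd_iff)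
  qed
  have fibre: "add_coset ?L ` {y \<in> zvec (Suc k). f y = f x}
      = (\<lambda>w. add_coset ?L (w(k := x k))) ` zvec k" if x: "x \<in> zvec (Suc k)" for x
  proof (intro equalityI subsetI)
    fix c assume "c \<in> add_coset ?L ` {y \<in> zvec (Suc k). f y = f x}"
    then obtain y where y: "y \<in> zvec (Suc k)" "f y = f x" "c = add_coset ?L y" by auto
    then have "g dvd y k - x k"
      unfolding f_def by (metis abs_dvd_iff mod_eq_dvd_iff)
    then obtain t where t: "y k - x k = g * t" by blast
    \<comment> \<open>Subtracting \<open>t\<close> times the last column stays in the coset and
      moves the last coordinate from \<open>y k\<close> to \<open>x k\<close>.\<close>
    let ?e = "\<lambda>i. if i = k then t else 0"
    have e: "?e \<in> zvec (Suc k)" by (auto simp: zvec_def)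
    let ?y = "y - mat_app A ?e"
    have yk: "?y k = x k"
      using app_k[of ?e] t by simp
    have y': "?y \<in> zvec (Suc k)"
      using add_subgroup_diff[OF add_subgroup_zvec y(1) mat_app_zvec[OF A]] .
    have "c = add_coset ?L ?y"
      using y(3) e by (simp add: add_coset_eq_iff L)
    \<comment> \<open>The truncation \<open>?y(k := 0)\<close> is the required witness in
      \<open>zvec k\<close>.\<close>
    also have "?y = (?y(k := 0))(k := x k)"
      using yk by auto
    finally show "c \<in> (\<lambda>w. add_coset ?L (w(k := x k))) ` zvec k"
      by (rule image_eqI[where f = "\<lambda>w. add_coset ?L (w(k := x k))"]) (use y' in \<open>auto simp: zvec_def\<close>)
  next
    fix c assume "c \<in> (\<lambda>w. add_coset ?L (w(k := x k))) ` zvec k"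
    then show "c \<in> add_coset ?L ` {y \<in> zvec (Suc k). f y = f x}"
      by (auto simp: zvec_def f_def intro!: imageI)
  qed
  have same: "add_coset ?L (v(k := t)) = add_coset ?L (w(k := t)) \<longleftrightarrow> add_coset ?L' v = add_coset ?L' w"
    if v: "v \<in> zvec k" and w: "w \<in> zvec k" for v w t
  proof -
    have "v(k := t) - w(k := t) = v - w"
      using v w by (auto simp: zvec_def fun_eq_iff)
    moreover have "v - w \<in> ?L \<longleftrightarrow> v - w \<in> ?L'"
    proof
      assume "v - w \<in> ?L"
      then obtain z where z: "z \<in> zvec (Suc k)" "v - w = mat_app A z" by auto
      then have "g * z k = (v - w) k" by (simp only: app_k)
      then have "z k = 0"
        using v w g0 by (simp add: zvec_def g_def)
      then have "z \<in> zvec k"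
        using z by (auto simp: zvec_def) (metis Suc_leI le_neq_implies_less)
      then show "v - w \<in> ?L'" using z app' by auto
    next
      assume "v - w \<in> ?L'"
      then obtain z where z: "z \<in> zvec k" "v - w = mat_app ?A' z" by auto
      then have "v - w = mat_app A z" "z \<in> zvec (Suc k)"
        using app' zvec_mono[of z k "Suc k"] by auto
      then show "v - w \<in> ?L" by blast
    qed
    ultimately show ?thesis
      by (simp add: add_coset_eq_iff L L')
  qed
  note same_card = card_image_if_same_fibres[of "zvec k" "\<lambda>w. add_coset ?L (w(k := _))", OF same]
  have fin: "finite (add_coset ?L ` zvec (Suc k))"
  proof (rule finite_image_refinement[where f = f])
    show "finite (f ` zvec (Suc k))" by (simp add: f_image)
  next
    fix x assume "x \<in> zvec (Suc k)"
    then show "finite (add_coset ?L ` {y \<in> zvec (Suc k). f y = f x})"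
      using IH by (simp only: fibre index_eq_det_def same_card)
  qed
  moreover have "card (add_coset ?L ` zvec (Suc k)) = card (add_coset ?L' ` zvec k) * card (f ` zvec (Suc k))"
  proof (rule card_image_refinement[OF fin])
    fix x assume "x \<in> zvec (Suc k)"
    then show "card (add_coset ?L ` {y \<in> zvec (Suc k). f y = f x}) = card (add_coset ?L' ` zvec k)"
      by (simp only: fibre same_card)
  qed (rule refine)
  ultimately show ?thesis
    using IH by (simp add: index_eq_det_def det_last_row[OF A row] f_image g_def abs_mult)
qed

lemma index_eq_det_cong:
  assumes "index_eq_det k B" "mat_app B ` zvec k = mat_app A ` zvec k" "\<bar>det B\<bar> = \<bar>det A\<bar>"
  shows "index_eq_det k A"
  using assms by (simp add: index_eq_det_def)

lemma sum_nat_abs_decrease: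
  fixes u v :: "nat \<Rightarrow> int"
  assumes "j < n" "\<And>i. i < n \<Longrightarrow> i \<noteq> j \<Longrightarrow> u i = v i" "\<bar>u j\<bar> < \<bar>v j\<bar>"
  shows "(\<Sum>i<n. nat \<bar>u i\<bar>) < (\<Sum>i<n. nat \<bar>v i\<bar>)"
proof (rule sum_strict_mono_ex1)
  show "\<forall>i\<in>{..<n}. nat \<bar>u i\<bar> \<le> nat \<bar>v i\<bar>"
  proof
    fix i assume "i \<in> {..<n}"
    then show "nat \<bar>u i\<bar> \<le> nat \<bar>v i\<bar>"
      using assms(2)[of i] assms(3) by (cases "i = j") auto
  qed
  show "\<exists>i\<in>{..<n}. nat \<bar>u i\<bar> < nat \<bar>v i\<bar>"
    using assms(1,3) by (intro bexI[of _ j]) auto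
qed simp

text \<open>One subtractive step of the Euclidean algorithm: the product of signs decides whether
  \<open>x\<close> is added to or subtracted from \<open>y\<close>.\<close>

lemma abs_reduce:
  fixes x y :: int
  assumes "x \<noteq> 0" "y \<noteq> 0" "\<bar>x\<bar> \<le> \<bar>y\<bar>"
  shows "\<bar>- (sgn x * sgn y) * x + y\<bar> < \<bar>y\<bar>"
  using assms by (cases "x > 0"; cases "y > 0") auto

text \<open>The Euclidean algorithm, run by column operations on the last row, clears everything
  left of the corner; then \<open>index_eq_det_last_row\<close> removes the last row and column. The
  outer induction is on the size, the inner one on the measure \<open>m\<close>.\<close>

lemma index_eq_det_if_nonzero:
  assumes "A \<in> carrier_mat k k" "det A \<noteq> 0"
  shows "index_eq_det k A"
  using assms
proof (induction k arbitrary: A)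
  case 0
  then have "zvec 0 = {0}" by (auto simp: zvec_def)
  then show ?case using 0 by (simp add: index_eq_det_def)
next
  case (Suc k)
  \<comment> \<open>A reduction shrinks the row sum. A swap keeps the row sum but puts a nonzero
    entry into an empty corner, which lowers the second summand.\<close>
  define m where "m A = 2 * (\<Sum>j<Suc k. nat \<bar>A $$ (k, j)\<bar>) + (if A $$ (k, k) = 0 then 1 else 0)" for A :: "int mat"
  show ?case
    using Suc.prems
  proof (induction "m A" arbitrary: A rule: less_induct)
    case less
    note A = less.prems(1)
    have step: ?case if "m B < m A" "B \<in> carrier_mat (Suc k) (Suc k)"
      "mat_app B ` zvec (Suc k) = mat_app A ` zvec (Suc k)" "\<bar>det B\<bar> = \<bar>det A\<bar>" for B
      by (rule index_eq_det_cong[of _ B]) (use less that in auto)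
    show ?case
    proof (cases "\<forall>j<k. A $$ (k, j) = 0")
      case True
      then have "det A = A $$ (k, k) * det (mat_delete A k k)"
        by (intro det_last_row[OF A]) auto
      then have "A $$ (k, k) \<noteq> 0" "det (mat_delete A k k) \<noteq> 0"
        using less.prems by auto
      then show ?thesis
        using True A by (intro index_eq_det_last_row Suc.IH mat_delete_carrier) auto
    next
      case False
      then obtain j where j: "j < k" "A $$ (k, j) \<noteq> 0" by auto
      show ?thesis
      proof (cases "A $$ (k, k) = 0")
        case True
        let ?B = "swapcols j k A"
        let ?p = "\<lambda>c. if c = j then k else if c = k then j else c"
        have "(\<Sum>c<Suc k. nat \<bar>?B $$ (k, c)\<bar>) = (\<Sum>c<Suc k. nat \<bar>A $$ (k, c)\<bar>)"
          by (rule sum.reindex_bij_witness[of _ ?p ?p]) (use A j in auto)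
        then have "m ?B < m A"
          using A j True by (simp add: m_def)
        then show ?thesis
          using A j by (intro step[of ?B]) (auto simp: mat_app_swapcols_image det_swapcols[of j "Suc k" k])
      next
        case False
        show ?thesis
        proof (cases "\<bar>A $$ (k, k)\<bar> \<le> \<bar>A $$ (k, j)\<bar>")
          case True
          let ?B = "addcol (- (sgn (A $$ (k, k)) * sgn (A $$ (k, j)))) j k A"
          have "(\<Sum>c<Suc k. nat \<bar>?B $$ (k, c)\<bar>) < (\<Sum>c<Suc k. nat \<bar>A $$ (k, c)\<bar>)"
            by (rule sum_nat_abs_decrease[of j]) (use A j True False abs_reduce[of "A $$ (k, k)" "A $$ (k, j)"] in auto)
          then have "m ?B < m A"
            using A j False by (simp add: m_def)
          then show ?thesis
            using A j by (intro step[of ?B]) (auto simp: mat_app_addcol_image det_addcol[of k "Suc k"])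
        next
          case less: False
          let ?B = "addcol (- (sgn (A $$ (k, j)) * sgn (A $$ (k, k)))) k j A"
          have "(\<Sum>c<Suc k. nat \<bar>?B $$ (k, c)\<bar>) < (\<Sum>c<Suc k. nat \<bar>A $$ (k, c)\<bar>)"
            by (rule sum_nat_abs_decrease[of k]) (use A j less False abs_reduce[of "A $$ (k, j)" "A $$ (k, k)"] in auto)
          \<comment> \<open>The corner can only vanish if both entries have the same absolute value,
            and that case belongs to the other branch.\<close>
          moreover have "?B $$ (k, k) \<noteq> 0"
          proof
            assume "?B $$ (k, k) = 0"
            then have "A $$ (k, k) = sgn (A $$ (k, j)) * sgn (A $$ (k, k)) * A $$ (k, j)"
              using A j by simp
            then have "\<bar>A $$ (k, k)\<bar> = \<bar>A $$ (k, j)\<bar>"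
              using j False by (metis abs_mult abs_sgn_eq_1 mult_1)
            then show False using less by simp
          qed
          ultimately have "m ?B < m A"
            using A j False by (simp add: m_def)
          then show ?thesis
            using A j by (intro step[of ?B]) (auto simp: mat_app_addcol_image det_addcol[of j "Suc k"])
        qed
      qed
    qed
  qed
qed

section \<open>Rational matrices acting on lattices\<close>

lemma mat_app_mult_mat_vec:
  assumes "A \<in> carrier_mat n k" "i < n"
  shows "mat_app A z i = (A *\<^sub>v vec k z) $ i"
  using assms by (simp add: mat_app_def scalar_prod_def lessThan_atLeast0)

lemma mat_app_of_int:
  assumes "A \<in> carrier_mat n k"
  shows "of_int (mat_app A z i) = mat_app (map_mat of_int A) (\<lambda>j. of_int (z j)) i"
  using assms by (simp add: mat_app_def)

lemma mat_app_eq_zero_imp: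
  fixes T :: "rat mat"
  assumes T: "T \<in> carrier_mat k k" "det T \<noteq> 0"
    and z: "\<And>i. i < k \<Longrightarrow> mat_app T z i = 0" and "i < k"
  shows "z i = 0"
proof -
  have "T *\<^sub>v vec k z = 0\<^sub>v k"
    using T z mat_app_mult_mat_vec[OF T(1)] by (intro eq_vecI) auto
  then have "vec k z = 0\<^sub>v k"
    using det_0_iff_vec_prod_zero[OF T(1)] T(2) by (metis vec_carrier)
  then show ?thesis
    using \<open>i < k\<close> by (metis index_vec index_zero_vec(1))
qed

lemma finite_add_coset_mono:
  assumes "add_subgroup B" "add_subgroup C" "C \<subseteq> B" "finite (add_coset C ` A)"
  shows "finite (add_coset B ` A)"
  by (rule finite_image_coarser[OF assms(4)]) (use assms(1-3) in \<open>auto simp: add_coset_eq_iff\<close>)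

text \<open>A nonzero vector \<open>u\<close> in the kernel of the transpose is orthogonal to the
  column space of \<open>T\<close>, hence to \<open>L\<close>. If \<open>u $ p\<close> is nonzero,
  distinct multiples of the unit vector at \<open>p\<close> have distinct products with
  \<open>u\<close> and so lie in distinct cosets.\<close>

lemma infinite_add_coset_singular:
  fixes T :: "rat mat"
  assumes T: "T \<in> carrier_mat k k" and det: "det T = 0" and L: "add_subgroup L"
    and img: "\<And>v. v \<in> L \<Longrightarrow> \<exists>z. \<forall>i<k. rat_of_int (v i) = mat_app T z i"
  shows "infinite (add_coset L ` zvec k)"
proof
  assume fin: "finite (add_coset L ` zvec k)"
  have "det (transpose_mat T) = 0"
    using det_transpose[OF T] det by simp
  then obtain u where u: "u \<in> carrier_vec k" "u \<noteq> 0\<^sub>v k" "transpose_mat T *\<^sub>v u = 0\<^sub>v k"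
    using det_0_iff_vec_prod_zero[of "transpose_mat T" k] T by auto
  then obtain p where p: "p < k" "u $ p \<noteq> 0"
    by (metis carrier_vecD eq_vecI index_zero_vec)
  have col: "(\<Sum>i<k. T $$ (i, j) * u $ i) = 0" if "j < k" for j
  proof -
    have "(transpose_mat T *\<^sub>v u) $ j = 0" using u that by simp
    then show ?thesis using that T u(1) by (simp add: scalar_prod_def lessThan_atLeast0)
  qed
  have ortho: "(\<Sum>i<k. u $ i * rat_of_int (v i)) = 0" if v: "v \<in> L" for v
  proof -
    obtain z where z: "\<And>i. i < k \<Longrightarrow> rat_of_int (v i) = mat_app T z i"
      using img[OF v] by blast
    have "(\<Sum>i<k. u $ i * rat_of_int (v i)) = (\<Sum>i<k. \<Sum>j<k. u $ i * (T $$ (i, j) * z j))"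
      using T by (intro sum.cong) (auto simp: z mat_app_def sum_distrib_left)
    also have "\<dots> = (\<Sum>j<k. (\<Sum>i<k. T $$ (i, j) * u $ i) * z j)"
      by (subst sum.swap) (simp add: sum_distrib_left ac_simps)
    finally show ?thesis by (simp add: col)
  qed
  define e where "e m = (\<lambda>i. if i = p then int m else 0)" for m
  have "inj (\<lambda>m. add_coset L (e m))"
  proof (rule injI)
    fix m m' assume "add_coset L (e m) = add_coset L (e m')"
    then have "(\<Sum>i<k. u $ i * rat_of_int ((e m - e m') i)) = 0"
      using ortho by (simp only: add_coset_eq_iff[OF L])
    also have "(\<Sum>i<k. u $ i * rat_of_int ((e m - e m') i))
        = (\<Sum>i<k. if i = p then u $ p * (of_nat m - of_nat m') else 0)"
      by (rule sum.cong) (auto simp: e_def)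
    finally show "m = m'" using p by simp
  qed
  moreover have "range (\<lambda>m. add_coset L (e m)) \<subseteq> add_coset L ` zvec k"
    using p by (auto simp: e_def zvec_def intro!: imageI)
  ultimately show False
    using fin by (meson finite_imageD finite_subset infinite_UNIV_nat)
qed

lemma sum_fun_value: "(\<Sum>c\<in>I. f c) i = (\<Sum>c\<in>I. f c i)"
  by (induction I rule: infinite_finite_induct) auto

text \<open>By the pigeonhole principle two multiples of each unit vector lie in the same coset, so
  a positive multiple of it lies in \<open>L\<close>. The product of these multipliers serves all
  coordinates at once.\<close>

lemma finite_index_contains_multiples:
  assumes L: "add_subgroup L" and fin: "finite (add_coset L ` zvec k)"
  obtains n :: nat where "n > 0" "\<And>z. z \<in> zvec k \<Longrightarrow> (\<lambda>i. int n * z i) \<in> L"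
proof -
  \<comment> \<open>\<open>e j m\<close> is \<open>m\<close> times the unit vector at
    \<open>j\<close>.\<close>
  define e where "e j m = (\<lambda>i. if i = j then m else 0)" for j :: nat and m :: int
  have e_add: "e j (l * m) \<in> L" if m: "e j m \<in> L" for j l m
  proof -
    have nat: "e j (int q * m) \<in> L" for q
    proof (induction q)
      case 0
      have "e j (int 0 * m) = 0" by (auto simp: e_def)
      then show ?case using add_subgroup_zero[OF L] by metis
    next
      case (Suc q)
      have "e j (int (Suc q) * m) = e j (int q * m) + e j m"
        by (auto simp: e_def fun_eq_iff algebra_simps)
      then show ?case using Suc add_subgroup_add[OF L] m by metis
    qed
    show ?thesis
    proof (cases "l \<ge> 0")
      case True
      then show ?thesis using nat[of "nat l"] by simp
    next
      case False
      then have "e j (l * m) = - e j (int (nat (-l)) * m)"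
        by (auto simp: e_def fun_eq_iff)
      then show ?thesis using nat[of "nat (-l)"] add_subgroup_uminus[OF L] by metis
    qed
  qed
  have "\<exists>n>0. e j (int n) \<in> L" if j: "j < k" for j
  proof -
    have "range (\<lambda>m. add_coset L (e j (int m))) \<subseteq> add_coset L ` zvec k"
      using j by (auto simp: e_def zvec_def intro!: imageI)
    then have "\<not> inj (\<lambda>m. add_coset L (e j (int m)))"
      using fin by (meson finite_imageD finite_subset infinite_UNIV_nat)
    then obtain a b where ab: "a < b" "add_coset L (e j (int b)) = add_coset L (e j (int a))"
      unfolding inj_def by (metis nat_neq_iff)
    then have "e j (int b) - e j (int a) \<in> L" by (simp add: add_coset_eq_iff L)
    moreover have "e j (int b) - e j (int a) = e j (int (b - a))"
      using ab by (auto simp: e_def fun_eq_iff)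
    ultimately show ?thesis using ab by (metis zero_less_diff)
  qed
  then obtain n where n: "\<And>j. j < k \<Longrightarrow> n j > 0 \<and> e j (int (n j)) \<in> L"
    by metis
  show thesis
  proof (rule that[of "\<Prod>j<k. n j"])
    show "0 < (\<Prod>j<k. n j)" using n by (intro prod_pos) auto
    fix z assume z: "z \<in> zvec k"
    have "(\<lambda>i. int (\<Prod>j<k. n j) * z i) = (\<Sum>c<k. e c (int (\<Prod>j<k. n j) * z c))"
    proof
      fix i
      have "(\<Sum>c<k. e c (int (\<Prod>j<k. n j) * z c)) i = (\<Sum>c<k. e c (int (\<Prod>j<k. n j) * z c) i)"
        by (rule sum_fun_value)
      also have "\<dots> = int (\<Prod>j<k. n j) * z i"
        using z by (auto simp: e_def zvec_def)
      finally show "int (\<Prod>j<k. n j) * z i = (\<Sum>c<k. e c (int (\<Prod>j<k. n j) * z c)) i" ..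
    qed
    also have "\<dots> \<in> L"
    proof (rule add_subgroup_sum[OF L])
      fix c assume "c \<in> {..<k}"
      then have "e c (int (n c)) \<in> L" "n c dvd (\<Prod>j<k. n j)"
        using n by auto
      then obtain q where q: "(\<Prod>j<k. n j) = n c * q" by auto
      then have "int (\<Prod>j<k. n j) * z c = (int q * z c) * int (n c)"
        by (simp only: of_nat_mult ac_simps)
      then show "e c (int (\<Prod>j<k. n j) * z c) \<in> L"
        using e_add[OF \<open>e c (int (n c)) \<in> L\<close>] by metis
    qed
    finally show "(\<lambda>i. int (\<Prod>j<k. n j) * z i) \<in> L" .
  qed
qed

lemma mat_app_smult_one:
  assumes "z \<in> zvec k"
  shows "mat_app (n \<cdot>\<^sub>m 1\<^sub>m k) z = (\<lambda>i. n * z i)"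
proof
  fix i
  have "(\<Sum>j<k. (n \<cdot>\<^sub>m 1\<^sub>m k) $$ (i, j) * z j) = (\<Sum>j<k. if j = i then n * z i else 0)" if "i < k"
    by (rule sum.cong) (use that in auto)
  then show "mat_app (n \<cdot>\<^sub>m 1\<^sub>m k) z i = n * z i"
    using assms by (auto simp: mat_app_def zvec_def)
qed

text \<open>Choose \<open>n\<close> with all multiples of \<open>n\<close> contained in
  \<open>L\<close>, and let \<open>D\<close> be the lattice of these multiples. On \<open>D\<close>
  the map is given by an integer matrix \<open>A\<close> equal to \<open>n\<close> times
  \<open>T\<close>, so the index of \<open>\<theta>\<close> D\<open>is\<close>n ^
  k\<open>times the absolute value of\<close>det T\<open>. Both\<close>n ^
  k\<open>and this index factor through\<close>L\<open>and\<close>\<theta> \<open>L\<close>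
  respectively, with the common factor \<open>[L : D]\<close>, because \<open>\<theta>\<close> is
  injective on \<open>L\<close>. Cancelling it gives the formula.\<close>

lemma card_add_coset_rational_image:
  fixes T :: "rat mat"
  assumes T: "T \<in> carrier_mat k k" and det: "det T \<noteq> 0"
    and L: "add_subgroup L" "L \<subseteq> zvec k" and fin: "finite (add_coset L ` zvec k)"
    and th: "\<And>z. z \<in> L \<Longrightarrow> \<theta> z \<in> zvec k"
      "\<And>z i. z \<in> L \<Longrightarrow> i < k \<Longrightarrow> rat_of_int (\<theta> z i) = mat_app T (\<lambda>j. rat_of_int (z j)) i"
  shows "finite (add_coset (\<theta> ` L) ` zvec k)"
    and "rat_of_nat (card (add_coset (\<theta> ` L) ` zvec k)) = \<bar>det T\<bar> * rat_of_nat (card (add_coset L ` zvec k))"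
proof -
  obtain n where n: "n > 0" "\<And>z. z \<in> zvec k \<Longrightarrow> (\<lambda>i. int n * z i) \<in> L"
    using finite_index_contains_multiples[OF L(1) fin] by metis
  \<comment> \<open>Written as the image of a scalar matrix, so that the determinant formula yields
    its index \<open>n ^ k\<close>.\<close>
  define D where "D = mat_app (int n \<cdot>\<^sub>m 1\<^sub>m k) ` zvec k"
  have D_eq: "D = (\<lambda>z i. int n * z i) ` zvec k"
    unfolding D_def by (rule image_cong) (auto simp: mat_app_smult_one)
  have D: "add_subgroup D" "D \<subseteq> L"
    using n by (auto simp: D_eq) (simp add: D_def[unfolded D_eq] add_subgroup_mat_app add_subgroup_zvec)
  have th_diff: "\<theta> (x - y) = \<theta> x - \<theta> y" if "x \<in> L" "y \<in> L" for x y
  proof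
    fix i
    have xy: "x - y \<in> L" using that add_subgroup_diff[OF L(1)] by blast
    show "\<theta> (x - y) i = (\<theta> x - \<theta> y) i"
    proof (cases "i < k")
      case True
      have "(\<lambda>j. rat_of_int ((x - y) j)) = (\<lambda>j. rat_of_int (x j)) - (\<lambda>j. rat_of_int (y j))"
        by auto
      then have "rat_of_int (\<theta> (x - y) i) = rat_of_int ((\<theta> x - \<theta> y) i)"
        using th(2)[OF xy True] th(2)[OF that(1) True] th(2)[OF that(2) True]
        by (simp add: mat_app_diff)
      then show ?thesis by (simp only: of_int_eq_iff)
    next
      case False
      then show ?thesis using th(1)[OF that(1)] th(1)[OF that(2)] th(1)[OF xy] by (simp add: zvec_def)
    qed
  qed
  have th_zero: "z = 0" if "z \<in> L" "\<theta> z = 0" for z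
  proof
    fix i
    show "z i = 0 i"
    proof (cases "i < k")
      case True
      have "rat_of_int (z i) = 0"
        by (rule mat_app_eq_zero_imp[OF T det _ True]) (use th(2)[OF that(1)] that(2) in simp)
      then show ?thesis by simp
    next
      case False
      then show ?thesis using L(2) that(1) by (auto simp: zvec_def)
    qed
  qed
  have inj: "inj_on \<theta> L"
  proof (rule inj_onI)
    fix x y assume "x \<in> L" "y \<in> L" "\<theta> x = \<theta> y"
    then have "x - y = 0"
      using th_zero[of "x - y"] th_diff add_subgroup_diff[OF L(1)] by simp
    then show "x = y" by (simp only: right_minus_eq)
  qed
  have thL: "add_subgroup (\<theta> ` L)" "\<theta> ` L \<subseteq> zvec k"
    using th(1) by (auto intro: add_subgroup_image L(1) th_diff)
  have thD: "add_subgroup (\<theta> ` D)"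
    using D by (auto intro!: add_subgroup_image th_diff)
  \<comment> \<open>Column \<open>j\<close> is the image of \<open>n\<close> times the unit vector
    at \<open>j\<close>, which lies in \<open>L\<close>; hence the entries are integers even though
    those of \<open>T\<close> need not be.\<close>
  define A where "A = mat k k (\<lambda>(i, j). \<theta> (\<lambda>c. int n * (if c = j then 1 else 0)) i)"
  have A: "A \<in> carrier_mat k k" by (simp add: A_def)
  have A_T: "map_mat of_int A = of_nat n \<cdot>\<^sub>m T"
  proof (rule eq_matI)
    fix i j assume ij: "i < dim_row (of_nat n \<cdot>\<^sub>m T)" "j < dim_col (of_nat n \<cdot>\<^sub>m T)"
    let ?z = "\<lambda>c. int n * (if c = j then 1 else 0)"
    have z: "?z \<in> L"
      using n(2)[of "\<lambda>c. if c = j then 1 else 0"] ij T by (auto simp: zvec_def)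
    have "rat_of_int (\<theta> ?z i) = (\<Sum>c<k. T $$ (i, c) * rat_of_int (?z c))"
      using th(2)[OF z, of i] ij T by (simp add: mat_app_def)
    also have "\<dots> = (\<Sum>c<k. if c = j then of_nat n * T $$ (i, j) else 0)"
      by (rule sum.cong) auto
    finally show "map_mat of_int A $$ (i, j) = (of_nat n \<cdot>\<^sub>m T) $$ (i, j)"
      using ij T by (simp add: A_def)
  qed (use T in \<open>auto simp: A_def\<close>)
  have "rat_of_int (det A) = det (map_mat rat_of_int A)"
    by simp
  then have det_A: "rat_of_int (det A) = of_nat n ^ k * det T"
    using T by (simp add: A_T det_smult)
  have A_image: "mat_app A ` zvec k = \<theta> ` D"
    unfolding D_eq image_image
  proof (rule image_cong[OF refl])
    fix z assume z: "z \<in> zvec k"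
    show "mat_app A z = \<theta> (\<lambda>i. int n * z i)"
    proof
      fix i
      show "mat_app A z i = \<theta> (\<lambda>i. int n * z i) i"
      proof (cases "i < k")
        case True
        have "rat_of_int (mat_app A z i) = mat_app (of_nat n \<cdot>\<^sub>m T) (\<lambda>j. rat_of_int (z j)) i"
          using mat_app_of_int[OF A, of z i] A_T by metis
        also have "\<dots> = mat_app T (\<lambda>j. rat_of_int (int n * z j)) i"
          using T True by (auto simp: mat_app_def intro!: sum.cong)
        also have "\<dots> = rat_of_int (\<theta> (\<lambda>i. int n * z i) i)"
          using th(2)[OF n(2)[OF z] True] by simp
        finally show ?thesis by simp
      next
        case False
        then show ?thesis
          using th(1)[OF n(2)[OF z]] A by (simp add: zvec_def mat_app_def)
      qed
    qed
  qed
  have "det A \<noteq> 0"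
    using det_A det n(1) by auto
  then have iA: "index_eq_det k A"
    by (rule index_eq_det_if_nonzero[OF A])
  have "index_eq_det k (int n \<cdot>\<^sub>m 1\<^sub>m k)"
    using n(1) by (intro index_eq_det_if_nonzero) (auto simp: det_smult)
  then have iD: "finite (add_coset D ` zvec k)" "card (add_coset D ` zvec k) = n ^ k"
    by (auto simp: index_eq_det_def D_def[symmetric] det_smult simp flip: of_nat_power)
  have fin_thD: "finite (add_coset (\<theta> ` D) ` zvec k)"
    using iA by (simp add: index_eq_det_def A_image)
  show "finite (add_coset (\<theta> ` L) ` zvec k)"
    by (rule finite_add_coset_mono[OF thL(1) thD _ fin_thD]) (use D in auto)
  have t1: "n ^ k = card (add_coset D ` L) * card (add_coset L ` zvec k)"
    using card_add_coset_tower[OF add_subgroup_zvec L(1) D(1) D(2) L(2) iD(1)] iD(2) by simp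
  have t2: "card (add_coset (\<theta> ` D) ` zvec k) = card (add_coset (\<theta> ` D) ` \<theta> ` L) * card (add_coset (\<theta> ` L) ` zvec k)"
    by (rule card_add_coset_tower[OF add_subgroup_zvec thL(1) thD _ thL(2) fin_thD]) (use D in auto)
  have t3: "card (add_coset (\<theta> ` D) ` \<theta> ` L) = card (add_coset D ` L)"
    unfolding image_image
  proof (rule card_image_if_same_fibres)
    fix x y assume xy: "x \<in> L" "y \<in> L"
    then have "x - y \<in> L" using add_subgroup_diff[OF L(1)] by blast
    then have "\<theta> (x - y) \<in> \<theta> ` D \<longleftrightarrow> x - y \<in> D"
      using inj D(2) by (meson inj_on_image_mem_iff)
    then show "add_coset (\<theta> ` D) (\<theta> x) = add_coset (\<theta> ` D) (\<theta> y) \<longleftrightarrow> add_coset D x = add_coset D y"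
      by (simp add: add_coset_eq_iff thD D(1) th_diff xy)
  qed
  have "rat_of_nat (card (add_coset (\<theta> ` D) ` zvec k)) = \<bar>rat_of_int (det A)\<bar>"
    using iA unfolding index_eq_det_def A_image by (metis of_int_abs of_int_of_nat_eq)
  also have "\<dots> = of_nat (n ^ k) * \<bar>det T\<bar>"
    by (simp add: det_A abs_mult)
  finally have "rat_of_nat (card (add_coset D ` L)) * rat_of_nat (card (add_coset (\<theta> ` L) ` zvec k))
      = rat_of_nat (card (add_coset D ` L)) * (\<bar>det T\<bar> * rat_of_nat (card (add_coset L ` zvec k)))"
    unfolding t2 t3 t1 by (simp add: ac_simps)
  \<comment> \<open>The common factor may be cancelled because it divides the positive number
    \<open>n ^ k\<close>.\<close>
  moreover have "card (add_coset D ` L) \<noteq> 0"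
    using t1 n(1) by (metis less_numeral_extra(3) mult_is_0 zero_less_power)
  ultimately show "rat_of_nat (card (add_coset (\<theta> ` L) ` zvec k)) = \<bar>det T\<bar> * rat_of_nat (card (add_coset L ` zvec k))"
    by simp
qed

section \<open>Lower central series and isolators\<close>

abbreviation gcomm :: "('a, 'b) monoid_scheme \<Rightarrow> 'a \<Rightarrow> 'a \<Rightarrow> 'a" where
  "gcomm G x y \<equiv> x \<otimes>\<^bsub>G\<^esub> y \<otimes>\<^bsub>G\<^esub> inv\<^bsub>G\<^esub> x \<otimes>\<^bsub>G\<^esub> inv\<^bsub>G\<^esub> y"

text \<open>The lower central series of \<open>K\<close> computed with the operations of the ambient
  \<open>G\<close>, so that the series of different subgroups can be compared.
  \<open>lcs0_subgroup_consistent\<close> identifies it with the series of the restricted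
  group.\<close>

fun rel_lcs :: "('a, 'b) monoid_scheme \<Rightarrow> 'a set \<Rightarrow> nat \<Rightarrow> 'a set" where
  "rel_lcs G K 0 = K"
| "rel_lcs G K (Suc n) = comm_subgroup G K (rel_lcs G K n)"

lemma rel_lcs_carrier: "rel_lcs G (carrier G) n = lcs0 G n"
  by (induction n) auto

context group
begin

lemma cancel_inv_left: "x \<in> carrier G \<Longrightarrow> y \<in> carrier G \<Longrightarrow> inv x \<otimes> (x \<otimes> y) = y"
  and cancel_inv_right: "x \<in> carrier G \<Longrightarrow> y \<in> carrier G \<Longrightarrow> x \<otimes> (inv x \<otimes> y) = y"
  by (simp_all add: m_assoc[symmetric])

text \<open>Brings group words into right-nested form and cancels adjacent inverses, which settles
  the commutator identities below.\<close>

lemmas word_simps = m_assoc inv_mult_group cancel_inv_left cancel_inv_right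

text \<open>Congruences modulo \<open>M\<close> become equations in a group \<open>Q\<close>. Only
  the projection and the relation it induces are exposed; the cosets stay hidden.\<close>

lemma quotient_map:
  assumes "M \<lhd> G"
  obtains Q :: "'a set monoid" and p where "group_hom G Q p"
    and "\<And>x y. x \<in> carrier G \<Longrightarrow> y \<in> carrier G \<Longrightarrow> p x = p y \<longleftrightarrow> inv x \<otimes> y \<in> M"
proof
  interpret M: normal M G by fact
  show "group_hom G (G Mod M) (\<lambda>x. M #> x)"
    by (intro group_hom.intro group_hom_axioms.intro M.r_coset_hom_Mod M.factorgroup_is_group) unfold_locales
  fix x y assume xy: "x \<in> carrier G" "y \<in> carrier G"
  have sub: "subgroup M G" by unfold_locales
  have "M #> x = M #> y \<longleftrightarrow> y \<in> M #> x"
    using xy sub repr_independence repr_independenceD by metis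
  also have "\<dots> \<longleftrightarrow> y \<in> x <# M"
    using M.coset_eq xy by simp
  also have "\<dots> \<longleftrightarrow> inv x \<otimes> y \<in> M"
  proof
    assume "y \<in> x <# M"
    then show "inv x \<otimes> y \<in> M"
      using xy M.subset by (auto simp: l_coset_def cancel_inv_left)
  next
    assume "inv x \<otimes> y \<in> M"
    then show "y \<in> x <# M"
      using xy by (auto simp: l_coset_def cancel_inv_right intro!: bexI[of _ "inv x \<otimes> y"])
  qed
  finally show "M #> x = M #> y \<longleftrightarrow> inv x \<otimes> y \<in> M" .
qed

text \<open>The inverses in \<open>c\<close> come from the form of \<open>p_eq\<close>: the element
  \<open>inv (u \<otimes> g) \<otimes> (g \<otimes> u)\<close> is literally the commutator of
  \<open>inv g\<close> and \<open>inv u\<close>.\<close>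

lemma quotient_commute:
  assumes p: "group_hom G Q p"
    and p_eq: "\<And>x y. x \<in> carrier G \<Longrightarrow> y \<in> carrier G \<Longrightarrow> p x = p y \<longleftrightarrow> inv x \<otimes> y \<in> M"
    and u: "u \<in> carrier G" and g: "g \<in> carrier G" and c: "gcomm G (inv g) (inv u) \<in> M"
  shows "p u \<otimes>\<^bsub>Q\<^esub> p g = p g \<otimes>\<^bsub>Q\<^esub> p u"
proof -
  interpret p: group_hom G Q p by fact
  have "inv (u \<otimes> g) \<otimes> (g \<otimes> u) = gcomm G (inv g) (inv u)"
    using u g by (simp add: word_simps)
  then have "p (u \<otimes> g) = p (g \<otimes> u)"
    using p_eq[of "u \<otimes> g" "g \<otimes> u"] u g c by (simp only: m_closed)
  then show ?thesis using u g by (simp only: p.hom_mult)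
qed

lemma gcomm_mult_left:
  assumes "x \<in> carrier G" "x' \<in> carrier G" "y \<in> carrier G"
  shows "gcomm G (x \<otimes> x') y = (x \<otimes> gcomm G x' y \<otimes> inv x) \<otimes> gcomm G x y"
  using assms by (simp add: word_simps)

lemma gcomm_mult_right:
  assumes "x \<in> carrier G" "y \<in> carrier G" "y' \<in> carrier G"
  shows "gcomm G x (y \<otimes> y') = gcomm G x y \<otimes> (y \<otimes> gcomm G x y' \<otimes> inv y)"
  using assms by (simp add: word_simps)

lemma gcomm_inv_left:
  assumes "x \<in> carrier G" "y \<in> carrier G"
  shows "gcomm G (inv x) y = inv x \<otimes> inv (gcomm G x y) \<otimes> inv (inv x)"
  using assms by (simp add: word_simps)

lemma inv_gcomm:
  assumes "x \<in> carrier G" "y \<in> carrier G"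
  shows "inv (gcomm G x y) = gcomm G y x"
  using assms by (simp add: word_simps)

lemma gcomm_eq_one_iff:
  assumes "x \<in> carrier G" "y \<in> carrier G"
  shows "gcomm G x y = \<one> \<longleftrightarrow> x \<otimes> y = y \<otimes> x"
proof -
  have "gcomm G x y = (x \<otimes> y) \<otimes> inv (y \<otimes> x)"
    using assms by (simp add: word_simps)
  then show ?thesis
    using assms by (metis inv_closed inv_equality inv_inv m_closed r_inv)
qed

lemma conj_commuting:
  assumes "x \<in> carrier G" "c \<in> carrier G" "c \<otimes> x = x \<otimes> c"
  shows "x \<otimes> c \<otimes> inv x = c"
  using assms by (metis inv_solve_right m_closed)

text \<open>When the commutator commutes with \<open>x\<close>, the conjugation in
  \<open>gcomm_mult_left\<close> disappears, so each further factor \<open>x\<close> contributes one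
  further copy of the commutator.\<close>

lemma gcomm_pow_left:
  assumes "x \<in> carrier G" "y \<in> carrier G" and c: "gcomm G x y \<otimes> x = x \<otimes> gcomm G x y"
  shows "gcomm G (x [^] (m::nat)) y = gcomm G x y [^] m"
proof (induction m)
  case 0
  then show ?case using assms by simp
next
  case (Suc m)
  let ?c = "gcomm G x y"
  have cl: "?c \<in> carrier G" using assms by simp
  have comm: "?c \<otimes> x [^] m = x [^] m \<otimes> ?c"
    using group_commutes_pow[of x ?c m] c assms cl by simp
  have "gcomm G (x [^] Suc m) y = (x [^] m \<otimes> ?c \<otimes> inv (x [^] m)) \<otimes> gcomm G (x [^] m) y"
    using gcomm_mult_left[of "x [^] m" x y] assms by simp
  also have "\<dots> = ?c \<otimes> ?c [^] m"
    using conj_commuting[OF _ cl comm] Suc.IH assms by simp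
  finally show ?case
    using nat_pow_Suc2[OF cl] by simp
qed

lemma gcomm_pow_right:
  assumes x: "x \<in> carrier G" and y: "y \<in> carrier G" and c: "gcomm G x y \<otimes> y = y \<otimes> gcomm G x y"
  shows "gcomm G x (y [^] (m::nat)) = gcomm G x y [^] m"
proof -
  have cl: "gcomm G y x \<in> carrier G" using assms by simp
  have "gcomm G y x \<otimes> y = y \<otimes> gcomm G y x"
  proof -
    have "inv (gcomm G x y) \<otimes> y = y \<otimes> inv (gcomm G x y)"
      using c x y by (metis inv_closed inv_solve_left inv_solve_right' m_assoc m_closed)
    then show ?thesis using x y by (simp only: inv_gcomm)
  qed
  then have "gcomm G (y [^] m) x = gcomm G y x [^] m"
    by (rule gcomm_pow_left[OF y x])
  then have "inv (gcomm G (y [^] m) x) = (inv (gcomm G y x)) [^] m"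
    by (simp only: nat_pow_inv[OF cl])
  then show ?thesis using x y by (simp only: inv_gcomm nat_pow_closed)
qed

lemma subgroup_nat_pow_closed:
  assumes "subgroup H G" "x \<in> H"
  shows "x [^] (n::nat) \<in> H"
  by (induction n) (use assms subgroup.one_closed subgroup.m_closed in auto)

text \<open>Lets a commutator condition in the first argument be checked on generators only:
  commutators of products and inverses are products of conjugates, and \<open>M\<close> is
  normal.\<close>

lemma subgroup_gcomm_mem:
  assumes M: "M \<lhd> G" and v: "v \<in> carrier G"
  shows "subgroup {u \<in> carrier G. gcomm G u v \<in> M} G"
proof (rule subgroupI)
  interpret M: normal M G by fact
  note conj = normal_invE(2)[OF M]
  show "{u \<in> carrier G. gcomm G u v \<in> M} \<noteq> {}"
    using v by (auto intro!: exI[of _ \<one>])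
  show "inv a \<in> {u \<in> carrier G. gcomm G u v \<in> M}" if a: "a \<in> {u \<in> carrier G. gcomm G u v \<in> M}" for a
    using a v conj[of "inv a" "inv (gcomm G a v)"] by (simp only: gcomm_inv_left mem_Collect_eq inv_closed M.m_inv_closed simp_thms)
  show "a \<otimes> b \<in> {u \<in> carrier G. gcomm G u v \<in> M}"
    if "a \<in> {u \<in> carrier G. gcomm G u v \<in> M}" "b \<in> {u \<in> carrier G. gcomm G u v \<in> M}" for a b
    using that v conj[of a "gcomm G b v"] by (simp only: gcomm_mult_left mem_Collect_eq m_closed M.m_closed simp_thms)
qed auto

section \<open>Commutator subgroups and the lower central series\<close>

lemma comm_subgroup_is_subgroup:
  assumes "A \<subseteq> carrier G" "B \<subseteq> carrier G"
  shows "subgroup (comm_subgroup G A B) G"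
  unfolding comm_subgroup_def by (rule generate_is_subgroup) (use assms in blast)

lemma comm_subgroup_mono:
  assumes "A \<subseteq> A'" "B \<subseteq> B'"
  shows "comm_subgroup G A B \<subseteq> comm_subgroup G A' B'"
  unfolding comm_subgroup_def by (rule mono_generate) (use assms in blast)

lemma gcomm_in_comm_subgroup:
  assumes "x \<in> A" "y \<in> B"
  shows "gcomm G x y \<in> comm_subgroup G A B"
  unfolding comm_subgroup_def by (rule generate.incl) (use assms in blast)

lemma comm_subgroup_least:
  assumes "subgroup M G" "\<And>x y. x \<in> A \<Longrightarrow> y \<in> B \<Longrightarrow> gcomm G x y \<in> M"
  shows "comm_subgroup G A B \<subseteq> M"
  unfolding comm_subgroup_def by (rule generate_subgroup_incl) (use assms in auto)

lemma rel_lcs_subset_subgroup: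
  assumes K: "subgroup K G"
  shows "subgroup (rel_lcs G K n) G \<and> rel_lcs G K n \<subseteq> K"
proof (induction n)
  case (Suc n)
  interpret K: subgroup K G by fact
  have "subgroup (rel_lcs G K (Suc n)) G"
    using Suc K.subset by (auto intro!: comm_subgroup_is_subgroup)
  moreover have "rel_lcs G K (Suc n) \<subseteq> K"
    unfolding rel_lcs.simps
  proof (rule comm_subgroup_least[OF K])
    fix x y assume "x \<in> K" "y \<in> rel_lcs G K n"
    then have "x \<in> K" "y \<in> K" using Suc by auto
    then show "gcomm G x y \<in> K" by simp
  qed
  ultimately show ?case by blast
qed (use K in auto)

lemmas rel_lcs_subgroup = rel_lcs_subset_subgroup[THEN conjunct1]
  and rel_lcs_subset = rel_lcs_subset_subgroup[THEN conjunct2]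

lemma rel_lcs_mono: "H \<subseteq> K \<Longrightarrow> rel_lcs G H n \<subseteq> rel_lcs G K n"
  by (induction n) (simp_all add: comm_subgroup_mono)

lemma rel_lcs_Suc_subset:
  assumes "subgroup K G"
  shows "rel_lcs G K (Suc n) \<subseteq> rel_lcs G K n"
proof (induction n)
  case 0
  then show ?case using rel_lcs_subset[OF assms, of 1] by simp
next
  case (Suc n)
  then show ?case using comm_subgroup_mono[OF order_refl Suc] by simp
qed

lemma rel_lcs_antimono:
  assumes "subgroup K G" "m \<le> n"
  shows "rel_lcs G K n \<subseteq> rel_lcs G K m"
  using assms(2) by (induction rule: dec_induct) (use rel_lcs_Suc_subset[OF assms(1)] in blast)+

lemma rel_lcs_consistent:
  assumes K: "subgroup K G" and H: "subgroup H G" "H \<subseteq> K"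
  shows "rel_lcs (G\<lparr>carrier := K\<rparr>) H n = rel_lcs G H n"
proof (induction n)
  case (Suc n)
  interpret K: subgroup K G by fact
  have sub: "rel_lcs G H n \<subseteq> H" using rel_lcs_subset[OF H(1)] .
  let ?X = "{gcomm G x y |x y. x \<in> H \<and> y \<in> rel_lcs G H n}"
  have "{gcomm (G\<lparr>carrier := K\<rparr>) x y |x y. x \<in> H \<and> y \<in> rel_lcs G H n} = ?X"
  proof -
    have "gcomm (G\<lparr>carrier := K\<rparr>) x y = gcomm G x y" if "x \<in> H" "y \<in> rel_lcs G H n" for x y
      using that H(2) sub by (simp add: m_inv_consistent[OF K] subsetD)
    then show ?thesis by (intro Collect_cong) metis
  qed
  moreover have "?X \<subseteq> K"
    using H(2) sub by blast
  ultimately show ?case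
    by (simp only: rel_lcs.simps comm_subgroup_def Suc generate_consistent[OF _ K])
qed simp

lemma lcs0_subgroup_consistent:
  assumes "subgroup K G"
  shows "lcs0 (G\<lparr>carrier := K\<rparr>) n = rel_lcs G K n"
  using rel_lcs_consistent[OF assms assms] rel_lcs_carrier[of "G\<lparr>carrier := K\<rparr>"] by simp

lemma lcs0_subgroup: "subgroup (lcs0 G n) G"
  using rel_lcs_subgroup[OF subgroup_self] by (simp add: rel_lcs_carrier)

lemma lcs0_antimono: "m \<le> n \<Longrightarrow> lcs0 G n \<subseteq> lcs0 G m"
  using rel_lcs_antimono[OF subgroup_self] by (simp add: rel_lcs_carrier)

text \<open>Conjugation by \<open>g\<close> sends the commutator of \<open>x\<close> and
  \<open>y\<close> to the commutator of their conjugates, so the generating set is stable.\<close>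

lemma lcs0_normal: "lcs0 G n \<lhd> G"
proof (induction n)
  case 0
  then show ?case by (simp add: normal_self)
next
  case (Suc n)
  have sub: "lcs0 G n \<subseteq> carrier G" using subgroup.subset[OF lcs0_subgroup] .
  show ?case
    unfolding lcs0.simps comm_subgroup_def
  proof (rule normal_generateI)
    show "{gcomm G x y |x y. x \<in> carrier G \<and> y \<in> lcs0 G n} \<subseteq> carrier G"
      using sub by blast
    fix h g assume g: "g \<in> carrier G" and "h \<in> {gcomm G x y |x y. x \<in> carrier G \<and> y \<in> lcs0 G n}"
    then obtain x y where xy: "x \<in> carrier G" "y \<in> lcs0 G n" "h = gcomm G x y" by blast
    have "g \<otimes> h \<otimes> inv g = gcomm G (g \<otimes> x \<otimes> inv g) (g \<otimes> y \<otimes> inv g)"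
      using g xy sub by (simp add: word_simps subsetD)
    moreover have "g \<otimes> y \<otimes> inv g \<in> lcs0 G n"
      using normal_invE(2)[OF Suc g xy(2)] .
    ultimately show "g \<otimes> h \<otimes> inv g \<in> {gcomm G x y |x y. x \<in> carrier G \<and> y \<in> lcs0 G n}"
      using g xy(1) by blast
  qed
qed

lemma gcomm_in_lcs0_Suc:
  assumes "x \<in> carrier G" "y \<in> lcs0 G n"
  shows "gcomm G x y \<in> lcs0 G (Suc n)"
  using gcomm_in_comm_subgroup[OF assms] by simp

section \<open>Powers in the lower central series\<close>

text \<open>Modulo \<open>M\<close> the subgroup \<open>A\<close> is central, so powers of a product
  are products of powers, and exponents \<open>m\<close> and \<open>m'\<close> combine to
  \<open>m * m'\<close>. For normality, conjugation changes an element of \<open>A\<close> only by a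
  commutator in \<open>M\<close>, and \<open>M\<close> lies in the set itself.\<close>

lemma power_subgroup_normal:
  assumes M: "M \<lhd> G" and A: "subgroup A G" and B: "subgroup B G" "B \<subseteq> A" and MA: "M \<subseteq> A"
    and central: "\<And>g a. g \<in> carrier G \<Longrightarrow> a \<in> A \<Longrightarrow> gcomm G g a \<in> M"
  shows "{x \<in> A. \<exists>m::nat>0. \<exists>h\<in>B. inv h \<otimes> x [^] m \<in> M} \<lhd> G" (is "?R \<lhd> G")
proof -
  obtain Q :: "'a set monoid" and p where p: "group_hom G Q p"
    and p_eq: "\<And>x y. x \<in> carrier G \<Longrightarrow> y \<in> carrier G \<Longrightarrow> p x = p y \<longleftrightarrow> inv x \<otimes> y \<in> M"
    using quotient_map[OF M] by metis
  interpret p: group_hom G Q p by fact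
  interpret A: subgroup A G by fact
  interpret B: subgroup B G by fact
  interpret M: normal M G by fact
  define R where "R = ?R"
  have R: "x \<in> R \<longleftrightarrow> x \<in> A \<and> (\<exists>m::nat>0. \<exists>h\<in>B. p h = p x [^]\<^bsub>Q\<^esub> m)" for x
  proof -
    have "inv h \<otimes> x [^] m \<in> M \<longleftrightarrow> p h = p x [^]\<^bsub>Q\<^esub> m" if "x \<in> A" "h \<in> B" for h and m :: nat
      using that by (simp add: p_eq[symmetric] p.hom_nat_pow)
    then show ?thesis unfolding R_def by blast
  qed
  have comm: "p x \<otimes>\<^bsub>Q\<^esub> p y = p y \<otimes>\<^bsub>Q\<^esub> p x" if "x \<in> A" "y \<in> carrier G" for x y
    by (rule quotient_commute[OF p p_eq]) (use that central[of "inv y" "inv x"] in auto)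
  have MR: "M \<subseteq> R"
  proof
    fix x assume x: "x \<in> M"
    then have "inv \<one> \<otimes> x [^] (1::nat) \<in> M" by (simp add: M.mem_carrier)
    moreover have "(0::nat) < 1" by simp
    ultimately show "x \<in> R" unfolding R_def using MA x B.one_closed by blast
  qed
  have sub: "subgroup R G"
  proof (rule subgroupI)
    show "R \<noteq> {}" using MR M.one_closed by blast
    show "inv a \<in> R" if "a \<in> R" for a
    proof -
      from that obtain m h where m: "a \<in> A" "m > (0::nat)" "h \<in> B" "p h = p a [^]\<^bsub>Q\<^esub> m"
        unfolding R by blast
      then have "p (inv h) = p (inv a) [^]\<^bsub>Q\<^esub> m"
        by (simp add: p.H.nat_pow_inv)
      then show ?thesis unfolding R using m by blast
    qed
    show "a \<otimes> b \<in> R" if "a \<in> R" "b \<in> R" for a b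
    proof -
      from that obtain m h m' h' where m: "a \<in> A" "m > (0::nat)" "h \<in> B" "p h = p a [^]\<^bsub>Q\<^esub> m"
        and m': "b \<in> A" "m' > (0::nat)" "h' \<in> B" "p h' = p b [^]\<^bsub>Q\<^esub> m'"
        unfolding R by blast
      have "p (a \<otimes> b) [^]\<^bsub>Q\<^esub> (m * m') = p a [^]\<^bsub>Q\<^esub> (m * m') \<otimes>\<^bsub>Q\<^esub> p b [^]\<^bsub>Q\<^esub> (m * m')"
        using m(1) m'(1) comm by (simp add: p.H.pow_mult_distrib)
      also have "p a [^]\<^bsub>Q\<^esub> (m * m') = p h [^]\<^bsub>Q\<^esub> m'"
        using m by (simp add: p.H.nat_pow_pow)
      also have "p b [^]\<^bsub>Q\<^esub> (m * m') = p h' [^]\<^bsub>Q\<^esub> m"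
        using m' by (simp add: p.H.nat_pow_pow mult.commute)
      also have "p h [^]\<^bsub>Q\<^esub> m' \<otimes>\<^bsub>Q\<^esub> p h' [^]\<^bsub>Q\<^esub> m = p (h [^] m' \<otimes> h' [^] m)"
        using m m' by (simp add: p.hom_nat_pow)
      finally have "p (h [^] m' \<otimes> h' [^] m) = p (a \<otimes> b) [^]\<^bsub>Q\<^esub> (m * m')" ..
      moreover have "h [^] m' \<otimes> h' [^] m \<in> B"
        using m m' subgroup_nat_pow_closed[OF B(1)] by blast
      ultimately show ?thesis unfolding R using m m' by (metis A.m_closed nat_0_less_mult_iff)
    qed
  qed (auto simp: R)
  interpret R: subgroup R G by fact
  show ?thesis
    unfolding R_def[symmetric]
  proof (rule normal_invI[OF sub])
    fix g a assume g: "g \<in> carrier G" and a: "a \<in> R"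
    have "a \<in> A" using a by (simp only: R)
    then have "gcomm G g a \<in> R" by (rule subsetD[OF MR central[OF g]])
    then have "gcomm G g a \<otimes> a \<in> R" using a by (rule R.m_closed)
    also have "gcomm G g a \<otimes> a = g \<otimes> a \<otimes> inv g"
      using g a by (simp add: word_simps)
    finally show "g \<otimes> a \<otimes> inv g \<in> R" .
  qed
qed

text \<open>Modulo the next term of the series, commutators are bilinear: if \<open>s [^] a\<close>
  lies in \<open>H\<close> and \<open>y [^] b\<close> is congruent to \<open>h\<close>, then the
  commutator of \<open>s\<close> and \<open>y\<close> to the power \<open>a * b\<close> is congruent
  to that of \<open>s [^] a\<close> and \<open>h\<close>. The elements with such a power form a
  normal subgroup, so it suffices to treat \<open>s\<close> in the generating set
  \<open>S\<close>.\<close>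

lemma lcs0_power_step:
  assumes H: "subgroup H G" and S: "S \<subseteq> carrier G" "generate G S = carrier G"
    and pow: "\<And>s. s \<in> S \<Longrightarrow> \<exists>m::nat>0. s [^] m \<in> H"
    and x: "x \<in> lcs0 G n"
  shows "\<exists>m::nat>0. \<exists>h\<in>rel_lcs G H n. inv h \<otimes> x [^] m \<in> lcs0 G (Suc n)"
  using x
proof (induction n arbitrary: x)
  case 0
  let ?R = "{x \<in> carrier G. \<exists>m::nat>0. \<exists>h\<in>H. inv h \<otimes> x [^] m \<in> lcs0 G (Suc 0)}"
  have "?R \<lhd> G"
  proof (rule power_subgroup_normal[OF lcs0_normal subgroup_self H])
    show "gcomm G g a \<in> lcs0 G (Suc 0)" if "g \<in> carrier G" "a \<in> carrier G" for g a
      using gcomm_in_lcs0_Suc[of g a 0] that by simp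
  qed (use subgroup.subset[OF H] subgroup.subset[OF lcs0_subgroup[of "Suc 0"]] in auto)
  moreover have "S \<subseteq> ?R"
  proof
    fix s assume s: "s \<in> S"
    then obtain m :: nat where m: "m > 0" "s [^] m \<in> H" using pow by blast
    then have "inv (s [^] m) \<otimes> s [^] m \<in> lcs0 G (Suc 0)"
      using s S(1) subgroup.one_closed[OF lcs0_subgroup[of "Suc 0"]] by (simp add: subsetD)
    then show "s \<in> ?R" using m s S(1) by blast
  qed
  ultimately have "generate G S \<subseteq> ?R"
    using generate_subgroup_incl normal_imp_subgroup by blast
  then show ?case using 0 S(2) by auto
next
  case (Suc n)
  let ?A = "lcs0 G (Suc n)" and ?B = "rel_lcs G H (Suc n)" and ?M = "lcs0 G (Suc (Suc n))"
  let ?R = "{x \<in> ?A. \<exists>m::nat>0. \<exists>h\<in>?B. inv h \<otimes> x [^] m \<in> ?M}"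
  have BA: "?B \<subseteq> ?A"
    using rel_lcs_mono[OF subgroup.subset[OF H], of "Suc n"] by (simp only: rel_lcs_carrier)
  have R: "?R \<lhd> G"
    by (rule power_subgroup_normal[OF lcs0_normal lcs0_subgroup rel_lcs_subgroup[OF H] BA
          lcs0_antimono gcomm_in_lcs0_Suc]) auto
  have "gcomm G x y \<in> ?R" if xy: "x \<in> carrier G" "y \<in> lcs0 G n" for x y
  proof -
    have y: "y \<in> carrier G" using xy(2) subgroup.subset[OF lcs0_subgroup] by blast
    have "S \<subseteq> {u \<in> carrier G. gcomm G u y \<in> ?R}"
    proof
      fix s assume "s \<in> S"
      then have s: "s \<in> carrier G" using S(1) by blast
      obtain a :: nat where a: "a > 0" "s [^] a \<in> H" using pow \<open>s \<in> S\<close> by blast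
      obtain b :: nat and h where b: "b > 0" "h \<in> rel_lcs G H n" "inv h \<otimes> y [^] b \<in> ?A"
        using Suc.IH[OF xy(2)] by blast
      have h: "h \<in> carrier G" using b(2) rel_lcs_subset[OF H] subgroup.subset[OF H] by blast
      \<comment> \<open>The error in replacing \<open>y [^] b\<close> by \<open>h\<close>. It lies
        in \<open>?A\<close>, which is central modulo \<open>?M\<close>, so it drops out of the
        commutator.\<close>
      define v where "v = inv h \<otimes> y [^] b"
      have v: "v \<in> carrier G" "y [^] b = h \<otimes> v"
        using h y by (simp_all add: v_def cancel_inv_right)
      obtain Q :: "'a set monoid" and p where p: "group_hom G Q p"
        and p_eq: "\<And>x y. x \<in> carrier G \<Longrightarrow> y \<in> carrier G \<Longrightarrow> p x = p y \<longleftrightarrow> inv x \<otimes> y \<in> ?M"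
        using quotient_map[OF lcs0_normal[of "Suc (Suc n)"]] by metis
      interpret p: group_hom G Q p by fact
      have central: "p u \<otimes>\<^bsub>Q\<^esub> p g = p g \<otimes>\<^bsub>Q\<^esub> p u" if "u \<in> ?A" "g \<in> carrier G" for u g
      proof -
        have u: "u \<in> carrier G" "inv u \<in> ?A"
          using that(1) subgroup.subset[OF lcs0_subgroup] subgroup.m_inv_closed[OF lcs0_subgroup] by blast+
        show ?thesis
          using gcomm_in_lcs0_Suc[OF _ u(2), of "inv g"] that(2) u(1) by (intro quotient_commute[OF p p_eq]) simp_all
      qed
      have c: "gcomm G s y \<in> ?A" "gcomm G (s [^] a) y \<in> ?A"
        using gcomm_in_lcs0_Suc xy(2) s nat_pow_closed by blast+
      have "p (gcomm G s y [^] (a * b)) = (gcomm Q (p s) (p y) [^]\<^bsub>Q\<^esub> a) [^]\<^bsub>Q\<^esub> b"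
        using s y by (simp add: p.hom_nat_pow p.H.nat_pow_pow)
      also have "gcomm Q (p s) (p y) [^]\<^bsub>Q\<^esub> a = gcomm Q (p (s [^] a)) (p y)"
        using p.H.gcomm_pow_left[of "p s" "p y" a] central[OF c(1) s] s y by (simp add: p.hom_nat_pow)
      also have "\<dots> [^]\<^bsub>Q\<^esub> b = gcomm Q (p (s [^] a)) (p (y [^] b))"
        using p.H.gcomm_pow_right[of "p (s [^] a)" "p y" b] central[OF c(2) y] s y by (simp add: p.hom_nat_pow)
      also have "\<dots> = gcomm Q (p (s [^] a)) (p h \<otimes>\<^bsub>Q\<^esub> p v)"
        using v h by simp
      also have "\<dots> = gcomm Q (p (s [^] a)) (p h)"
      proof -
        have "gcomm Q (p (s [^] a)) (p v) = \<one>\<^bsub>Q\<^esub>"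
          using central[of v "s [^] a"] b(3) v(1) s by (subst p.H.gcomm_eq_one_iff) (auto simp: v_def)
        then show ?thesis
          using s h v(1) by (subst p.H.gcomm_mult_right) auto
      qed
      also have "\<dots> = p (gcomm G (s [^] a) h)"
        using s h by simp
      finally have "inv (gcomm G (s [^] a) h) \<otimes> gcomm G s y [^] (a * b) \<in> ?M"
        using s y h by (metis p_eq m_closed inv_closed nat_pow_closed)
      moreover have "gcomm G (s [^] a) h \<in> ?B"
        using gcomm_in_comm_subgroup[OF a(2) b(2)] by simp
      ultimately have "gcomm G s y \<in> ?R"
        using c(1) a(1) b(1) by (metis (no_types, lifting) mem_Collect_eq nat_0_less_mult_iff)
      then show "s \<in> {u \<in> carrier G. gcomm G u y \<in> ?R}"
        using s by blast
    qed
    then have "generate G S \<subseteq> {u \<in> carrier G. gcomm G u y \<in> ?R}"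
      by (rule generate_subgroup_incl[OF _ subgroup_gcomm_mem[OF R y]])
    then show ?thesis using S(2) xy(1) by blast
  qed
  then have "?A \<subseteq> ?R"
    unfolding lcs0.simps(2)[of G n] by (rule comm_subgroup_least[OF normal_imp_subgroup[OF R[unfolded lcs0.simps(2)[of G n]]]])
  then show ?case using Suc.prems by blast
qed

text \<open>The congruence of \<open>lcs0_power_step\<close> is pushed down the series. The error
  \<open>v\<close> is central modulo the next term, and some power of it is congruent to an element
  \<open>h'\<close> of the series of \<open>H\<close>; raising to that power replaces
  \<open>h\<close> by \<open>h [^] b \<otimes> h'\<close> and moves the error one term deeper. By
  nilpotency the error finally vanishes.\<close>

lemma lcs0_power:
  assumes H: "subgroup H G" and S: "S \<subseteq> carrier G" "generate G S = carrier G"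
    and pow: "\<And>s. s \<in> S \<Longrightarrow> \<exists>m::nat>0. s [^] m \<in> H"
    and nil: "lcs0 G c = {\<one>}" and x: "x \<in> lcs0 G n"
  shows "\<exists>m::nat>0. x [^] m \<in> rel_lcs G H n"
proof -
  have xc: "x \<in> carrier G" using x subgroup.subset[OF lcs0_subgroup] by blast
  interpret B: subgroup "rel_lcs G H n" G by (rule rel_lcs_subgroup[OF H])
  have "\<exists>m::nat>0. \<exists>h\<in>rel_lcs G H n. inv h \<otimes> x [^] m \<in> lcs0 G (Suc j)" if "n \<le> j" for j
    using that
  proof (induction j rule: dec_induct)
    case base
    show ?case by (rule lcs0_power_step[OF H S pow x])
  next
    case (step j)
    obtain m :: nat and h where m: "m > 0" "h \<in> rel_lcs G H n" "inv h \<otimes> x [^] m \<in> lcs0 G (Suc j)"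
      using step.IH by blast
    define v where "v = inv h \<otimes> x [^] m"
    have v: "v \<in> carrier G" "x [^] m = h \<otimes> v"
      using m(2) xc by (simp_all add: v_def cancel_inv_right)
    obtain b :: nat and h' where b: "b > 0" "h' \<in> rel_lcs G H (Suc j)"
        "inv h' \<otimes> v [^] b \<in> lcs0 G (Suc (Suc j))"
      using lcs0_power_step[OF H S pow, of v "Suc j"] m(3) unfolding v_def by blast
    have h': "h' \<in> rel_lcs G H n"
      using b(2) rel_lcs_antimono[OF H, of n "Suc j"] step.hyps by auto
    obtain Q :: "'a set monoid" and p where p: "group_hom G Q p"
      and p_eq: "\<And>x y. x \<in> carrier G \<Longrightarrow> y \<in> carrier G \<Longrightarrow> p x = p y \<longleftrightarrow> inv x \<otimes> y \<in> lcs0 G (Suc (Suc j))"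
      using quotient_map[OF lcs0_normal[of "Suc (Suc j)"]] by metis
    interpret p: group_hom G Q p by fact
    have "inv v \<in> lcs0 G (Suc j)"
      using m(3) subgroup.m_inv_closed[OF lcs0_subgroup] unfolding v_def by blast
    then have comm: "p h \<otimes>\<^bsub>Q\<^esub> p v = p v \<otimes>\<^bsub>Q\<^esub> p h"
      using quotient_commute[OF p p_eq v(1), of h] gcomm_in_lcs0_Suc[of "inv h" "inv v" "Suc j"] m(2)
      by (metis B.mem_carrier inv_closed)
    have "p (x [^] (m * b)) = p (x [^] m) [^]\<^bsub>Q\<^esub> b"
      using xc by (simp add: p.hom_nat_pow p.H.nat_pow_pow)
    also have "\<dots> = p h [^]\<^bsub>Q\<^esub> b \<otimes>\<^bsub>Q\<^esub> p v [^]\<^bsub>Q\<^esub> b"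
      using v m(2) p.H.pow_mult_distrib[OF comm] by simp
    also have "p v [^]\<^bsub>Q\<^esub> b = p h'"
      using b(3) v(1) h' p_eq[of h' "v [^] b"] by (simp add: p.hom_nat_pow)
    also have "p h [^]\<^bsub>Q\<^esub> b \<otimes>\<^bsub>Q\<^esub> p h' = p (h [^] b \<otimes> h')"
      using m(2) h' by (simp add: p.hom_nat_pow)
    finally have "inv (h [^] b \<otimes> h') \<otimes> x [^] (m * b) \<in> lcs0 G (Suc (Suc j))"
      using m(2) h' xc by (metis B.mem_carrier m_closed nat_pow_closed p_eq)
    moreover have "h [^] b \<otimes> h' \<in> rel_lcs G H n"
      using m(2) h' subgroup_nat_pow_closed[OF rel_lcs_subgroup[OF H]] by blast
    ultimately show ?case
      using m(1) b(1) by (metis nat_0_less_mult_iff)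
  qed
  \<comment> \<open>The maximum meets the condition \<open>n \<le> j\<close> and at the same time
    reaches the trivial part of the series.\<close>
  from this[of "max n c"] obtain m :: nat and h where m: "m > 0" "h \<in> rel_lcs G H n"
      "inv h \<otimes> x [^] m \<in> lcs0 G (Suc (max n c))"
    by auto
  moreover have "lcs0 G (Suc (max n c)) \<subseteq> {\<one>}"
    using lcs0_antimono[of c "Suc (max n c)"] nil by auto
  ultimately have "x [^] m = h"
    using xc by (metis B.mem_carrier inv_solve_left nat_pow_closed one_closed r_one singletonD subsetD)
  then show ?thesis using m by blast
qed

section \<open>Isolators of the lower central series\<close>

lemma isolator_subset: "L \<subseteq> carrier G \<Longrightarrow> L \<subseteq> isolator G L"
  unfolding isolator_def by (auto intro!: exI[of _ "1::nat"])

lemma isolator_iff: "x \<in> isolator G L \<longleftrightarrow> x \<in> carrier G \<and> (\<exists>m::nat>0. x [^] m \<in> L)"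
  by (auto simp: isolator_def)

lemma isolator_mono: "L \<subseteq> L' \<Longrightarrow> isolator G L \<subseteq> isolator G L'"
  by (meson isolator_iff subset_iff)

lemma subgroup_lcs0_nilpotent:
  assumes "subgroup K G" "lcs0 G c = {\<one>}"
  shows "lcs0 (G\<lparr>carrier := K\<rparr>) c = {\<one>}"
proof -
  have "rel_lcs G K c \<subseteq> {\<one>}"
    using rel_lcs_mono[OF subgroup.subset[OF assms(1)], of c] assms(2) by (simp add: rel_lcs_carrier)
  moreover have "\<one> \<in> rel_lcs G K c"
    using subgroup.one_closed[OF rel_lcs_subgroup[OF assms(1)]] .
  ultimately show ?thesis
    by (auto simp: lcs0_subgroup_consistent[OF assms(1)])
qed

text \<open>\<open>lcs0_power\<close> applied inside the subgroup generated by \<open>S\<close>,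
  which inherits nilpotency, and then read back in \<open>G\<close>.\<close>

lemma rel_lcs_power:
  assumes H: "subgroup H G" and S: "S \<subseteq> carrier G" and HK: "H \<subseteq> generate G S"
    and pow: "\<And>s. s \<in> S \<Longrightarrow> \<exists>m::nat>0. s [^] m \<in> H"
    and nil: "lcs0 G c = {\<one>}" and x: "x \<in> rel_lcs G (generate G S) n"
  shows "\<exists>m::nat>0. x [^] m \<in> rel_lcs G H n"
proof -
  let ?K = "generate G S" and ?GK = "G\<lparr>carrier := generate G S\<rparr>"
  have K: "subgroup ?K G" by (rule generate_is_subgroup[OF S])
  interpret K: group ?GK by (rule subgroup_imp_group[OF K])
  have SK: "S \<subseteq> ?K" by (auto intro: generate.incl)
  have "\<exists>m::nat>0. x [^]\<^bsub>?GK\<^esub> m \<in> rel_lcs ?GK H n"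
  proof (rule K.lcs0_power[of H S c])
    show "subgroup H ?GK" by (rule subgroup_incl[OF H K HK])
    show "generate ?GK S = carrier ?GK"
      using generate_consistent[OF SK K] by simp
    show "lcs0 ?GK c = {\<one>\<^bsub>?GK\<^esub>}"
      using subgroup_lcs0_nilpotent[OF K nil] by simp
    show "x \<in> lcs0 ?GK n"
      using x by (simp add: lcs0_subgroup_consistent[OF K])
    show "\<exists>m::nat>0. s [^]\<^bsub>?GK\<^esub> m \<in> H" if "s \<in> S" for s
      using pow[OF that] by (simp add: nat_pow_consistent[symmetric])
  qed (use SK in simp)
  then show ?thesis
    by (simp add: nat_pow_consistent[symmetric] rel_lcs_consistent[OF K H HK])
qed

text \<open>Take the isolator itself as generating set in \<open>rel_lcs_power\<close> at level 0:
  every element it generates has a power in \<open>H\<close>, so it already equals the subgroup it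
  generates.\<close>

lemma isolator_subgroup:
  assumes nil: "lcs0 G c = {\<one>}" and H: "subgroup H G"
  shows "subgroup (isolator G H) G"
proof -
  have I: "isolator G H \<subseteq> carrier G" by (auto simp: isolator_iff)
  have "generate G (isolator G H) \<subseteq> isolator G H"
  proof
    fix x assume x: "x \<in> generate G (isolator G H)"
    have "\<exists>m::nat>0. x [^] m \<in> rel_lcs G H 0"
    proof (rule rel_lcs_power[OF H I _ _ nil])
      show "H \<subseteq> generate G (isolator G H)"
        using isolator_subset[OF subgroup.subset[OF H]] generate.incl[of _ "isolator G H" G] by blast
    qed (use x in \<open>auto simp: isolator_iff\<close>)
    then show "x \<in> isolator G H"
      using generate_in_carrier[OF I x] by (simp add: isolator_iff)
  qed
  moreover have "isolator G H \<subseteq> generate G (isolator G H)"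
    by (auto intro: generate.incl)
  ultimately show ?thesis
    using generate_is_subgroup[OF I] by (metis subset_antisym)
qed

lemma conj_nat_pow:
  assumes "g \<in> carrier G" "x \<in> carrier G"
  shows "(g \<otimes> x \<otimes> inv g) [^] (m::nat) = g \<otimes> x [^] m \<otimes> inv g"
proof (induction m)
  case (Suc m)
  then show ?case using assms by (simp add: word_simps)
qed (use assms in simp)

lemma isolator_normal:
  assumes nil: "lcs0 G c = {\<one>}" and M: "M \<lhd> G"
  shows "isolator G M \<lhd> G"
proof (rule normal_invI[OF isolator_subgroup[OF nil normal_imp_subgroup[OF M]]])
  fix g x assume g: "g \<in> carrier G" and "x \<in> isolator G M"
  then obtain m :: nat where x: "x \<in> carrier G" "m > 0" "x [^] m \<in> M"
    by (auto simp: isolator_iff)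
  then have "(g \<otimes> x \<otimes> inv g) [^] m \<in> M"
    using conj_nat_pow[OF g x(1)] normal_invE(2)[OF M g x(3)] by simp
  then show "g \<otimes> x \<otimes> inv g \<in> isolator G M"
    using g x by (auto simp: isolator_iff)
qed

text \<open>The condition is extended from generators one argument at a time. Inverting the
  commutator exchanges its arguments, so \<open>subgroup_gcomm_mem\<close> serves for both.\<close>

lemma generate_commute_mod:
  assumes M: "M \<lhd> G" and S: "S \<subseteq> carrier G"
    and comm: "\<And>u v. u \<in> S \<Longrightarrow> v \<in> S \<Longrightarrow> gcomm G u v \<in> M"
    and "u \<in> generate G S" "v \<in> generate G S"
  shows "gcomm G u v \<in> M"
proof -
  interpret M: normal M G by fact
  have *: "gcomm G u v \<in> M" if "u \<in> generate G S" "v \<in> S" for u v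
  proof -
    have "generate G S \<subseteq> {u \<in> carrier G. gcomm G u v \<in> M}"
      by (rule generate_subgroup_incl[OF _ subgroup_gcomm_mem[OF M]]) (use that S comm in blast)+
    then show ?thesis using that by blast
  qed
  have uc: "u \<in> carrier G" using generate_in_carrier[OF S] assms(4) by blast
  have "S \<subseteq> {w \<in> carrier G. gcomm G w u \<in> M}"
  proof
    fix w assume w: "w \<in> S"
    then have "inv (gcomm G u w) \<in> M" using *[OF assms(4) w] by simp
    then show "w \<in> {w \<in> carrier G. gcomm G w u \<in> M}"
      using w S uc inv_gcomm[of u w] by auto
  qed
  then have "generate G S \<subseteq> {w \<in> carrier G. gcomm G w u \<in> M}"
    by (rule generate_subgroup_incl[OF _ subgroup_gcomm_mem[OF M uc]])
  then have v: "v \<in> carrier G" "gcomm G v u \<in> M" using assms(5) by auto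
  then have "inv (gcomm G v u) \<in> M" by (intro M.m_inv_closed)
  then show ?thesis using inv_gcomm[OF v(1) uc] by simp
qed

text \<open>This makes the isolator series central. Compare the subgroup generated by
  \<open>x\<close> and \<open>y\<close> with the one generated by \<open>x [^] m\<close> and
  \<open>y\<close>. By \<open>rel_lcs_power\<close>, a power of the commutator lies in the derived
  subgroup of the latter, and that is contained in \<open>?M\<close> because its generators commute
  modulo \<open>?M\<close>.\<close>

lemma gcomm_in_isolator_lcs0_Suc:
  assumes nil: "lcs0 G c = {\<one>}" and y: "y \<in> carrier G" and x: "x \<in> isolator G (lcs0 G n)"
  shows "gcomm G y x \<in> isolator G (lcs0 G (Suc n))"
proof -
  obtain m :: nat where m: "x \<in> carrier G" "m > 0" "x [^] m \<in> lcs0 G n"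
    using x by (auto simp: isolator_iff)
  let ?M = "lcs0 G (Suc n)" and ?S = "{x, y}" and ?T = "{x [^] m, y}"
  interpret M: normal ?M G by (rule lcs0_normal)
  have S: "?S \<subseteq> carrier G" and T: "?T \<subseteq> carrier G" using m y by auto
  have K: "subgroup (generate G ?S) G" by (rule generate_is_subgroup[OF S])
  have H: "subgroup (generate G ?T) G" by (rule generate_is_subgroup[OF T])
  have xy: "x \<in> generate G ?S" "y \<in> generate G ?S" by (auto intro: generate.incl)
  have c1: "gcomm G y (x [^] m) \<in> ?M" by (rule gcomm_in_lcs0_Suc[OF y m(3)])
  then have c2: "gcomm G (x [^] m) y \<in> ?M"
    using M.m_inv_closed[OF c1] inv_gcomm[of y "x [^] m"] y m(1) by simp
  have "\<exists>l::nat>0. gcomm G y x [^] l \<in> rel_lcs G (generate G ?T) (Suc 0)"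
  proof (rule rel_lcs_power[OF H S _ _ nil])
    show "generate G ?T \<subseteq> generate G ?S"
      by (rule generate_subgroup_incl[OF _ K]) (use xy subgroup_nat_pow_closed[OF K] in auto)
    show "gcomm G y x \<in> rel_lcs G (generate G ?S) (Suc 0)"
      using gcomm_in_comm_subgroup[OF xy(2,1)] by simp
    show "\<exists>l::nat>0. s [^] l \<in> generate G ?T" if s: "s \<in> ?S" for s
    proof (cases "s = x")
      case True
      then show ?thesis using m(2) generate.incl[of "x [^] m" ?T G] by auto
    next
      case False
      then have "s [^] (1::nat) \<in> generate G ?T"
        using s y generate.incl[of y ?T G] by auto
      then show ?thesis by (intro exI[of _ "1::nat"]) simp
    qed
  qed
  moreover have "rel_lcs G (generate G ?T) (Suc 0) \<subseteq> ?M"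
    unfolding rel_lcs.simps
  proof (rule comm_subgroup_least[OF lcs0_subgroup], rule generate_commute_mod[OF lcs0_normal T])
    fix u v assume "u \<in> ?T" "v \<in> ?T"
    then show "gcomm G u v \<in> ?M"
      using c1 c2 m(1) y M.one_closed by (elim insertE emptyE) (simp_all only: gcomm_eq_one_iff[THEN iffD2] nat_pow_closed)
  qed
  ultimately show ?thesis
    using m(1) y by (auto simp: isolator_iff)
qed

text \<open>One inclusion is monotonicity of the series. For the other, \<open>lcs0_power\<close>
  with the whole carrier as generating set turns a power in the series of \<open>G\<close> into a
  further power in the series of \<open>H\<close>.\<close>

lemma isolator_lcs0_subgroup:
  assumes nil: "lcs0 G c = {\<one>}" and H: "subgroup H G"
    and pow: "\<And>x. x \<in> carrier G \<Longrightarrow> \<exists>m::nat>0. x [^] m \<in> H"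
  shows "isolator (G\<lparr>carrier := H\<rparr>) (lcs0 (G\<lparr>carrier := H\<rparr>) n) = H \<inter> isolator G (lcs0 G n)"
proof (intro equalityI subsetI)
  fix x assume "x \<in> isolator (G\<lparr>carrier := H\<rparr>) (lcs0 (G\<lparr>carrier := H\<rparr>) n)"
  then obtain m :: nat where "x \<in> H" "m > 0" "x [^] m \<in> rel_lcs G H n"
    by (auto simp: isolator_def lcs0_subgroup_consistent[OF H] nat_pow_consistent[symmetric])
  then show "x \<in> H \<inter> isolator G (lcs0 G n)"
    using rel_lcs_mono[OF subgroup.subset[OF H], of n] subgroup.subset[OF H]
    by (auto simp: isolator_iff rel_lcs_carrier)
next
  fix x assume "x \<in> H \<inter> isolator G (lcs0 G n)"
  then obtain m :: nat where x: "x \<in> H" "x \<in> carrier G" "m > 0" "x [^] m \<in> lcs0 G n"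
    by (auto simp: isolator_iff)
  have "generate G (carrier G) = carrier G"
    using generate_incl[of "carrier G"] by (auto intro: generate.incl)
  then obtain l :: nat where "l > 0" "(x [^] m) [^] l \<in> rel_lcs G H n"
    using lcs0_power[OF H order_refl _ pow nil x(4)] by blast
  then show "x \<in> isolator (G\<lparr>carrier := H\<rparr>) (lcs0 (G\<lparr>carrier := H\<rparr>) n)"
    using x by (auto simp: isolator_def lcs0_subgroup_consistent[OF H] nat_pow_consistent[symmetric] nat_pow_pow
        intro!: exI[of _ "m * l"])
qed

section \<open>Finite index and homomorphisms\<close>

text \<open>Two of the infinitely many powers of \<open>x\<close> share a coset of \<open>H\<close>;
  their quotient is again a power.\<close>

lemma finite_index_power_mem:
  assumes H: "subgroup H G" and fin: "finite (rcosets H)" and x: "x \<in> carrier G"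
  shows "\<exists>m::nat>0. x [^] m \<in> H"
proof -
  have "range (\<lambda>m::nat. H #> x [^] m) \<subseteq> rcosets H"
    using x subgroup.subset[OF H] by (auto intro: rcosetsI)
  then have "\<not> inj (\<lambda>m::nat. H #> x [^] m)"
    using fin by (meson finite_imageD finite_subset infinite_UNIV_nat)
  then obtain a b :: nat where ab: "a < b" "H #> x [^] a = H #> x [^] b"
    unfolding inj_def by (metis nat_neq_iff)
  then have "x [^] b \<in> H #> x [^] a"
    using rcos_self[OF _ H, of "x [^] b"] x by simp
  then have "x [^] b \<otimes> inv (x [^] a) \<in> H"
    using subgroup.rcos_module_imp[OF H is_group] x by simp
  also have "x [^] b = x [^] (b - a) \<otimes> x [^] a"
    using ab x by (simp add: nat_pow_mult)
  finally have "x [^] (b - a) \<in> H"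
    using x by (simp add: m_assoc)
  then show ?thesis using ab by (intro exI[of _ "b - a"]) auto
qed

lemma hom_lcs0:
  assumes H: "subgroup H G" and f: "f \<in> hom (G\<lparr>carrier := H\<rparr>) G" and x: "x \<in> lcs0 (G\<lparr>carrier := H\<rparr>) n"
  shows "f x \<in> lcs0 G n"
proof -
  let ?H = "G\<lparr>carrier := H\<rparr>"
  interpret f: group_hom ?H G f
    by (intro group_hom.intro group_hom_axioms.intro subgroup_imp_group[OF H] f is_group)
  have "f ` lcs0 ?H n \<subseteq> lcs0 G n"
  proof (induction n)
    case 0
    then show ?case using f by (auto simp: hom_def)
  next
    case (Suc n)
    let ?X = "{gcomm ?H x y |x y. x \<in> carrier ?H \<and> y \<in> lcs0 ?H n}"
    have sub: "lcs0 ?H n \<subseteq> carrier ?H"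
      using subgroup.subset[OF f.G.lcs0_subgroup] .
    have "f ` generate ?H ?X = generate G (f ` ?X)"
      by (rule f.generate_img[symmetric]) (use sub in blast)
    moreover have "generate G (f ` ?X) \<subseteq> lcs0 G (Suc n)"
    proof (rule generate_subgroup_incl[OF _ lcs0_subgroup])
      show "f ` ?X \<subseteq> lcs0 G (Suc n)"
      proof
        fix z assume "z \<in> f ` ?X"
        then obtain x y where xy: "x \<in> carrier ?H" "y \<in> lcs0 ?H n" "z = f (gcomm ?H x y)" by blast
        have "y \<in> carrier ?H" using xy sub by blast
        then have "z = gcomm G (f x) (f y)"
          using xy by (simp only: f.hom_mult f.hom_inv f.G.m_closed f.G.inv_closed)
        then show "z \<in> lcs0 G (Suc n)"
          using gcomm_in_lcs0_Suc[of "f x" "f y" n] Suc xy(1,2) f.hom_closed by blast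
      qed
    qed
    ultimately show ?case by (simp only: lcs0.simps comm_subgroup_def)
  qed
  then show ?thesis using x by blast
qed

lemma hom_isolator_lcs0:
  assumes H: "subgroup H G" and f: "f \<in> hom (G\<lparr>carrier := H\<rparr>) G"
    and x: "x \<in> isolator (G\<lparr>carrier := H\<rparr>) (lcs0 (G\<lparr>carrier := H\<rparr>) n)"
  shows "f x \<in> isolator G (lcs0 G n)"
proof -
  let ?H = "G\<lparr>carrier := H\<rparr>"
  interpret f: group_hom ?H G f
    by (intro group_hom.intro group_hom_axioms.intro subgroup_imp_group[OF H] f is_group)
  obtain m :: nat where m: "x \<in> carrier ?H" "m > 0" "x [^]\<^bsub>?H\<^esub> m \<in> lcs0 ?H n"
    using x unfolding isolator_def by blast
  then have "f x [^] m \<in> lcs0 G n"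
    using hom_lcs0[OF H f m(3)] f.hom_nat_pow[OF m(1)] by simp
  then show ?thesis
    using m f.hom_closed by (auto simp: isolator_iff)
qed

end

section \<open>Twisted conjugacy along a central filtration\<close>

text \<open>In the application \<open>F j\<close> is the isolator with one-based index
  \<open>j + 1\<close>, and \<open>\<kappa> j\<close> gives coordinates of \<open>F j\<close> modulo
  \<open>F (Suc j)\<close>; its values outside \<open>F j\<close> are unconstrained. The
  homomorphism is a parameter because the locale is used twice, for \<open>\<phi>\<close> and for
  the trivial map.\<close>

locale twisted_filtration = group G for G (structure) +
  fixes F :: "nat \<Rightarrow> 'a set" and c :: nat and k :: "nat \<Rightarrow> nat"
    and \<kappa> :: "nat \<Rightarrow> 'a \<Rightarrow> nat \<Rightarrow> int" and H :: "'a set" and \<phi> :: "'a \<Rightarrow> 'a"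
  assumes F_normal: "F j \<lhd> G"
    and F_0: "F 0 = carrier G" and F_c: "F c = {\<one>}" and F_Suc: "F (Suc j) \<subseteq> F j"
    and F_central: "g \<in> carrier G \<Longrightarrow> x \<in> F j \<Longrightarrow> gcomm G g x \<in> F (Suc j)"
    and \<kappa>_mult: "j < c \<Longrightarrow> x \<in> F j \<Longrightarrow> y \<in> F j \<Longrightarrow> \<kappa> j (x \<otimes> y) = \<kappa> j x + \<kappa> j y"
    and \<kappa>_image: "j < c \<Longrightarrow> \<kappa> j ` F j = zvec (k j)"
    and \<kappa>_kernel: "j < c \<Longrightarrow> x \<in> F j \<Longrightarrow> \<kappa> j x = 0 \<longleftrightarrow> x \<in> F (Suc j)"
    and H_subgroup: "subgroup H G"
    and \<phi>_hom: "\<phi> \<in> hom (G\<lparr>carrier := H\<rparr>) G"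
    and \<phi>_F: "h \<in> H \<Longrightarrow> h \<in> F j \<Longrightarrow> \<phi> h \<in> F j"
begin

sublocale H: subgroup H G by (rule H_subgroup)

lemma \<phi>_group_hom: "group_hom (G\<lparr>carrier := H\<rparr>) G \<phi>"
  by (intro group_hom.intro group_hom_axioms.intro subgroup_imp_group[OF H_subgroup] \<phi>_hom is_group)

lemma \<phi>_closed [simp]: "h \<in> H \<Longrightarrow> \<phi> h \<in> carrier G"
  using group_hom.hom_closed[OF \<phi>_group_hom] by simp

lemma \<phi>_mult: "h \<in> H \<Longrightarrow> h' \<in> H \<Longrightarrow> \<phi> (h \<otimes> h') = \<phi> h \<otimes> \<phi> h'"
  using group_hom.hom_mult[OF \<phi>_group_hom] by simp

lemma \<phi>_one: "\<phi> \<one> = \<one>"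
  using group_hom.hom_one[OF \<phi>_group_hom] by simp

lemma \<phi>_inv: "h \<in> H \<Longrightarrow> \<phi> (inv h) = inv (\<phi> h)"
  using group_hom.hom_inv[OF \<phi>_group_hom, of h] m_inv_consistent[OF H_subgroup] by simp

lemma F_subgroup: "subgroup (F j) G"
  using F_normal normal_imp_subgroup by blast

lemma F_carrier: "x \<in> F j \<Longrightarrow> x \<in> carrier G"
  using subgroup.subset[OF F_subgroup] by blast

lemma F_mult: "x \<in> F j \<Longrightarrow> y \<in> F j \<Longrightarrow> x \<otimes> y \<in> F j"
  using subgroup.m_closed[OF F_subgroup] .

lemma F_inv: "x \<in> F j \<Longrightarrow> inv x \<in> F j"
  using subgroup.m_inv_closed[OF F_subgroup] .

lemma F_one: "\<one> \<in> F j"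
  using subgroup.one_closed[OF F_subgroup] .

lemma F_conj: "g \<in> carrier G \<Longrightarrow> x \<in> F j \<Longrightarrow> g \<otimes> x \<otimes> inv g \<in> F j"
  using normal_invE(2)[OF F_normal] .

text \<open>For the trivial homomorphism the twisted classes are the right cosets of
  \<open>H\<close>, so the same count expresses the index of \<open>H\<close>.\<close>

lemma trivial_twisted_filtration: "twisted_filtration G F c k \<kappa> H (\<lambda>_. \<one>)"
proof (rule twisted_filtration.intro[OF is_group], rule twisted_filtration_axioms.intro)
  show "(\<lambda>_. \<one>) \<in> hom (G\<lparr>carrier := H\<rparr>) G" by (simp add: hom_def)
qed (fact F_normal F_0 F_c F_Suc F_central \<kappa>_mult \<kappa>_image \<kappa>_kernel H_subgroup | rule F_one)+

lemma \<kappa>_one: "j < c \<Longrightarrow> \<kappa> j \<one> = 0"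
  using \<kappa>_kernel F_one by blast

lemma \<kappa>_inv:
  assumes "j < c" "x \<in> F j"
  shows "\<kappa> j (inv x) = - \<kappa> j x"
proof -
  have "\<kappa> j x + \<kappa> j (inv x) = 0"
    using \<kappa>_mult[OF assms F_inv[OF assms(2)]] \<kappa>_one[OF assms(1)] F_carrier[OF assms(2)]
    by (simp only: r_inv)
  then show ?thesis by (simp only: minus_unique)
qed

section \<open>The twisted action and its classes modulo the filtration\<close>

definition tw :: "'a \<Rightarrow> 'a \<Rightarrow> 'a" where
  "tw h x = h \<otimes> x \<otimes> inv (\<phi> h)"

lemma tw_closed: "h \<in> H \<Longrightarrow> x \<in> carrier G \<Longrightarrow> tw h x \<in> carrier G"
  by (simp add: tw_def)

lemma tw_one: "x \<in> carrier G \<Longrightarrow> tw \<one> x = x"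
  by (simp add: tw_def \<phi>_one)

lemma tw_tw: "h \<in> H \<Longrightarrow> h' \<in> H \<Longrightarrow> x \<in> carrier G \<Longrightarrow> tw h (tw h' x) = tw (h \<otimes> h') x"
  by (simp add: tw_def word_simps \<phi>_mult)

lemma tw_mult: "h \<in> H \<Longrightarrow> x \<in> carrier G \<Longrightarrow> f \<in> carrier G \<Longrightarrow>
    tw h (x \<otimes> f) = tw h x \<otimes> (\<phi> h \<otimes> f \<otimes> inv (\<phi> h))"
  by (simp add: tw_def word_simps)

text \<open>The preimage in \<open>G\<close> of the orbit of \<open>x\<close> modulo
  \<open>F j\<close>. Working with preimages keeps the classes of all levels in one type; level 0
  has a single class and level \<open>c\<close> gives the twisted classes themselves.\<close>

definition cls :: "nat \<Rightarrow> 'a \<Rightarrow> 'a set" where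
  "cls j x = {tw h x \<otimes> f |h f. h \<in> H \<and> f \<in> F j}"

lemma cls_self: "x \<in> carrier G \<Longrightarrow> x \<in> cls j x"
  unfolding cls_def using F_one[of j] tw_one[of x] by (force intro: exI[of _ \<one>])

lemma cls_subset:
  assumes x: "x \<in> carrier G" and y: "y \<in> cls j x"
  shows "cls j y \<subseteq> cls j x"
proof
  fix z assume "z \<in> cls j y"
  then obtain h f where h: "h \<in> H" "f \<in> F j" "z = tw h y \<otimes> f"
    by (auto simp: cls_def)
  obtain h' f' where h': "h' \<in> H" "f' \<in> F j" "y = tw h' x \<otimes> f'"
    using y by (auto simp: cls_def)
  have "z = tw (h \<otimes> h') x \<otimes> (\<phi> h \<otimes> f' \<otimes> inv (\<phi> h) \<otimes> f)"
    using h h' x F_carrier by (simp add: tw_mult tw_closed tw_tw m_assoc)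
  moreover have "\<phi> h \<otimes> f' \<otimes> inv (\<phi> h) \<otimes> f \<in> F j"
    using h h' by (intro F_mult F_conj) auto
  ultimately show "z \<in> cls j x"
    using h(1) h'(1) unfolding cls_def by blast
qed

lemma cls_carrier: "x \<in> carrier G \<Longrightarrow> y \<in> cls j x \<Longrightarrow> y \<in> carrier G"
  unfolding cls_def using F_carrier by (auto simp: tw_closed)

lemma cls_sym:
  assumes x: "x \<in> carrier G" and y: "y \<in> cls j x"
  shows "x \<in> cls j y"
proof -
  obtain h f where h: "h \<in> H" "f \<in> F j" "y = tw h x \<otimes> f"
    using y by (auto simp: cls_def)
  have f: "f \<in> carrier G" using F_carrier h(2) .
  let ?g = "inv (inv (\<phi> h) \<otimes> f \<otimes> inv (inv (\<phi> h)))"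
  have "x = tw (inv h) y \<otimes> ?g"
    using h(1,3) x f by (simp add: tw_def word_simps \<phi>_inv)
  moreover have "?g \<in> F j"
    using h by (intro F_inv F_conj) auto
  ultimately show ?thesis
    using h(1) unfolding cls_def by blast
qed

lemma cls_eq_iff:
  assumes "x \<in> carrier G" "y \<in> carrier G"
  shows "cls j x = cls j y \<longleftrightarrow> y \<in> cls j x"
proof
  assume "cls j x = cls j y"
  then show "y \<in> cls j x" using cls_self[OF assms(2)] by simp
next
  assume "y \<in> cls j x"
  then show "cls j x = cls j y"
    using cls_subset cls_sym assms by (metis subset_antisym)
qed

lemma cls_refine:
  assumes "x \<in> carrier G" "y \<in> carrier G" "cls (Suc j) x = cls (Suc j) y"
  shows "cls j x = cls j y"
proof -
  have "y \<in> cls (Suc j) x" using assms cls_eq_iff by simp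
  then have "y \<in> cls j x" unfolding cls_def using F_Suc[of j] by blast
  then show ?thesis using assms cls_eq_iff by simp
qed

lemma cls_0_image: "cls 0 ` carrier G = {carrier G}"
proof -
  have "cls 0 x = carrier G" if x: "x \<in> carrier G" for x
  proof
    show "carrier G \<subseteq> cls 0 x"
    proof
      fix y assume y: "y \<in> carrier G"
      then have "y = tw \<one> x \<otimes> (inv x \<otimes> y)" "inv x \<otimes> y \<in> F 0"
        using x by (simp_all add: tw_one F_0 cancel_inv_right)
      then show "y \<in> cls 0 x" unfolding cls_def using H.one_closed by blast
    qed
  qed (use cls_carrier x in blast)
  then show ?thesis by (auto simp: image_def)
qed

lemma cls_c_image: "cls c ` carrier G = twisted_classes G H \<phi>"
proof -
  have "cls c x = {h \<otimes> x \<otimes> inv (\<phi> h) |h. h \<in> H}" if "x \<in> carrier G" for x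
  proof -
    have "tw h x \<otimes> \<one> = h \<otimes> x \<otimes> inv (\<phi> h)" if "h \<in> H" for h
      using that \<open>x \<in> carrier G\<close> by (simp add: tw_def)
    then show ?thesis
      unfolding cls_def F_c by (intro Collect_cong) (metis singletonD singletonI)
  qed
  then show ?thesis
    unfolding twisted_classes_def by (intro image_cong) auto
qed

section \<open>Stabilizers and translation lattices\<close>

text \<open>On each layer of the filtration this induces the identity minus the map induced by
  \<open>\<phi>\<close>, as \<open>\<kappa>_\<psi>\<close> shows. Accordingly
  \<open>\<Lambda> j\<close> is the lattice of translations on layer \<open>j\<close>, and
  \<open>\<psi>_inj j\<close> says that the induced map has trivial kernel there.\<close>

definition \<psi> :: "'a \<Rightarrow> 'a" where
  "\<psi> h = h \<otimes> inv (\<phi> h)"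

definition \<Lambda> :: "nat \<Rightarrow> (nat \<Rightarrow> int) set" where
  "\<Lambda> j = (\<lambda>h. \<kappa> j (\<psi> h)) ` (H \<inter> F j)"

definition \<psi>_inj :: "nat \<Rightarrow> bool" where
  "\<psi>_inj j \<longleftrightarrow> (\<forall>h \<in> H \<inter> F j. \<psi> h \<in> F (Suc j) \<longrightarrow> h \<in> F (Suc j))"

lemma \<psi>_F: "h \<in> H \<Longrightarrow> h \<in> F j \<Longrightarrow> \<psi> h \<in> F j"
  unfolding \<psi>_def by (intro F_mult F_inv \<phi>_F)

lemma \<kappa>_\<psi>: "j < c \<Longrightarrow> h \<in> H \<Longrightarrow> h \<in> F j \<Longrightarrow> \<kappa> j (\<psi> h) = \<kappa> j h - \<kappa> j (\<phi> h)"
  unfolding \<psi>_def using \<kappa>_mult[of j h "inv (\<phi> h)"] \<kappa>_inv[of j "\<phi> h"] \<phi>_F F_inv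
  by (simp only: diff_conv_add_uminus)

lemma add_subgroup_\<Lambda>:
  assumes j: "j < c"
  shows "add_subgroup (\<Lambda> j)"
  unfolding add_subgroup_def
proof (intro conjI ballI)
  have "\<kappa> j (\<psi> \<one>) = 0" using \<kappa>_one[OF j] by (simp add: \<psi>_def \<phi>_one)
  then show "0 \<in> \<Lambda> j"
    unfolding \<Lambda>_def using F_one[of j] by (metis (no_types, lifting) H.one_closed IntI image_eqI)
next
  fix u v assume "u \<in> \<Lambda> j" "v \<in> \<Lambda> j"
  then obtain h h' where h: "h \<in> H" "h \<in> F j" "u = \<kappa> j (\<psi> h)" and h': "h' \<in> H" "h' \<in> F j" "v = \<kappa> j (\<psi> h')"
    unfolding \<Lambda>_def by blast
  let ?h = "h \<otimes> inv h'"
  have H: "?h \<in> H" "?h \<in> F j"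
    using h h' F_mult F_inv by auto
  have e1: "\<kappa> j ?h = \<kappa> j h - \<kappa> j h'"
    using \<kappa>_mult[OF j h(2) F_inv[OF h'(2)]] \<kappa>_inv[OF j h'(2)] by simp
  have e2: "\<kappa> j (\<phi> ?h) = \<kappa> j (\<phi> h) - \<kappa> j (\<phi> h')"
    using \<kappa>_mult[OF j \<phi>_F[OF h(1,2)] F_inv[OF \<phi>_F[OF h'(1,2)]]] \<kappa>_inv[OF j \<phi>_F[OF h'(1,2)]] h h'
    by (simp add: \<phi>_mult \<phi>_inv)
  have "\<kappa> j (\<psi> ?h) = u - v"
    unfolding h(3) h'(3) \<kappa>_\<psi>[OF j H] \<kappa>_\<psi>[OF j h(1,2)] \<kappa>_\<psi>[OF j h'(1,2)] e1 e2
    by (simp only: algebra_simps)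
  then show "u - v \<in> \<Lambda> j"
    unfolding \<Lambda>_def using H by (metis (no_types, lifting) IntI image_eqI)
qed

text \<open>For \<open>h\<close> in \<open>F j\<close> the commutator falls into
  \<open>F (Suc j)\<close>, so modulo \<open>F (Suc j)\<close> the displacement of \<open>x\<close>
  is \<open>\<psi> h\<close>, independently of \<open>x\<close>.\<close>

lemma inv_tw_eq:
  assumes "h \<in> H" "x \<in> carrier G"
  shows "inv x \<otimes> tw h x = gcomm G (inv x) h \<otimes> \<psi> h"
  using assms by (simp add: tw_def \<psi>_def word_simps)

text \<open>An element fixing the coset of \<open>x\<close> is driven down the filtration: if it
  lies in \<open>F j\<close>, then so deep a displacement forces \<open>\<psi> h\<close> into
  \<open>F (Suc j)\<close>, and injectivity puts \<open>h\<close> there too.\<close>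

lemma stabilizer:
  assumes "\<And>i. i < j \<Longrightarrow> \<psi>_inj i" and h: "h \<in> H" and x: "x \<in> carrier G"
    and "inv x \<otimes> tw h x \<in> F j"
  shows "h \<in> F j"
  using assms(1,4)
proof (induction j)
  case 0
  then show ?case using h F_0 by simp
next
  case (Suc j)
  have "h \<in> F j"
    by (rule Suc.IH) (use Suc.prems F_Suc in auto)
  then have "gcomm G (inv x) h \<in> F (Suc j)" by (intro F_central inv_closed x)
  then have "inv (gcomm G (inv x) h) \<otimes> (gcomm G (inv x) h \<otimes> \<psi> h) \<in> F (Suc j)"
    using Suc.prems(2) unfolding inv_tw_eq[OF h x] by (rule F_mult[OF F_inv])
  also have "inv (gcomm G (inv x) h) \<otimes> (gcomm G (inv x) h \<otimes> \<psi> h) = \<psi> h"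
    by (rule cancel_inv_left) (use h x in \<open>auto simp: \<psi>_def\<close>)
  finally show ?case
    using Suc.prems(1)[of j] h \<open>h \<in> F j\<close> unfolding \<psi>_inj_def by blast
qed

lemma inv_tw_F:
  assumes j: "j < c" and h: "h \<in> H" "h \<in> F j" and x: "x \<in> carrier G"
  shows "inv x \<otimes> tw h x \<in> F j" and "\<kappa> j (inv x \<otimes> tw h x) = \<kappa> j (\<psi> h)"
proof -
  have g: "gcomm G (inv x) h \<in> F (Suc j)" by (intro F_central inv_closed x h)
  then have g': "gcomm G (inv x) h \<in> F j" using F_Suc by blast
  show "inv x \<otimes> tw h x \<in> F j"
    unfolding inv_tw_eq[OF h(1) x] by (rule F_mult[OF g' \<psi>_F[OF h]])
  show "\<kappa> j (inv x \<otimes> tw h x) = \<kappa> j (\<psi> h)"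
    unfolding inv_tw_eq[OF h(1) x]
    using \<kappa>_mult[OF j g' \<psi>_F[OF h]] \<kappa>_kernel[OF j g'] g by simp
qed

text \<open>Two elements of the coset of \<open>x\<close> modulo \<open>F j\<close> can only be
  identified by some \<open>h\<close> stabilizing that coset. By \<open>stabilizer\<close> such
  \<open>h\<close> lie in \<open>F j\<close>, and those act on the coordinates as translations by
  \<open>\<Lambda> j\<close>.\<close>

lemma cls_Suc_eq_iff:
  assumes j: "j < c" and inj: "\<And>i. i < j \<Longrightarrow> \<psi>_inj i" and x: "x \<in> carrier G"
    and n: "n \<in> F j" and n': "n' \<in> F j"
  shows "cls (Suc j) (x \<otimes> n) = cls (Suc j) (x \<otimes> n') \<longleftrightarrow>
    add_coset (\<Lambda> j) (\<kappa> j n) = add_coset (\<Lambda> j) (\<kappa> j n')"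
proof -
  let ?u = "x \<otimes> n"
  have u: "?u \<in> carrier G" and nc: "n \<in> carrier G" "n' \<in> carrier G" using x n n' F_carrier by auto
  \<comment> \<open>The displacement of \<open>?u\<close> under \<open>h\<close>, measured on the
    right as in \<open>inv_tw_F\<close>.\<close>
  define E where "E h = inv ?u \<otimes> tw h ?u" for h
  have E: "E h \<in> carrier G" if "h \<in> H" for h using that u tw_closed by (simp add: E_def)
  have nn: "inv n \<otimes> n' \<in> F j" by (intro F_mult F_inv n n')
  have \<kappa>nn: "\<kappa> j (inv n \<otimes> n') = \<kappa> j n' - \<kappa> j n"
    using \<kappa>_mult[OF j F_inv[OF n] n'] \<kappa>_inv[OF j n] by simp
  have iff: "x \<otimes> n' = tw h ?u \<otimes> f \<longleftrightarrow> inv (E h) \<otimes> (inv n \<otimes> n') = f"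
    if h: "h \<in> H" and f: "f \<in> carrier G" for h f
  proof -
    have "inv (E h) \<otimes> (inv n \<otimes> n') = inv (tw h ?u) \<otimes> (x \<otimes> n')"
      using h x nc tw_closed[OF h u] by (simp add: E_def word_simps)
    then show ?thesis
      using h x nc tw_closed[OF h u] f inv_solve_left[of f "tw h ?u" "x \<otimes> n'"] by auto
  qed
  have "cls (Suc j) ?u = cls (Suc j) (x \<otimes> n') \<longleftrightarrow> x \<otimes> n' \<in> cls (Suc j) ?u"
    using cls_eq_iff u x nc by simp
  also have "\<dots> \<longleftrightarrow> (\<exists>h\<in>H. inv (E h) \<otimes> (inv n \<otimes> n') \<in> F (Suc j))"
    unfolding cls_def using iff F_carrier[of _ "Suc j"] by blast
  also have "\<dots> \<longleftrightarrow> \<kappa> j n' - \<kappa> j n \<in> \<Lambda> j"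
  proof
    assume "\<exists>h\<in>H. inv (E h) \<otimes> (inv n \<otimes> n') \<in> F (Suc j)"
    then obtain h where h: "h \<in> H" "inv (E h) \<otimes> (inv n \<otimes> n') \<in> F (Suc j)" by blast
    have "(inv n \<otimes> n') \<otimes> inv (inv (E h) \<otimes> (inv n \<otimes> n')) \<in> F j"
      using nn h(2) F_Suc by (blast intro: F_mult F_inv)
    also have "(inv n \<otimes> n') \<otimes> inv (inv (E h) \<otimes> (inv n \<otimes> n')) = E h"
      using E[OF h(1)] nc by (simp add: word_simps)
    finally have EF: "E h \<in> F j" .
    have hF: "h \<in> F j"
      by (rule stabilizer[OF inj h(1) u]) (use EF in \<open>simp_all add: E_def\<close>)
    have "\<kappa> j (inv (E h) \<otimes> (inv n \<otimes> n')) = 0"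
      using \<kappa>_kernel[OF j F_mult[OF F_inv[OF EF] nn]] h(2) by blast
    then have "\<kappa> j n' - \<kappa> j n = \<kappa> j (E h)"
      using \<kappa>_mult[OF j F_inv[OF EF] nn] \<kappa>_inv[OF j EF] \<kappa>nn by (metis add.commute add.left_inverse add_left_imp_eq)
    also have "\<dots> = \<kappa> j (\<psi> h)"
      unfolding E_def by (rule inv_tw_F(2)[OF j h(1) hF u])
    finally show "\<kappa> j n' - \<kappa> j n \<in> \<Lambda> j"
      unfolding \<Lambda>_def using h(1) hF by blast
  next
    assume "\<kappa> j n' - \<kappa> j n \<in> \<Lambda> j"
    then obtain h where h: "h \<in> H" "h \<in> F j" "\<kappa> j n' - \<kappa> j n = \<kappa> j (\<psi> h)"
      unfolding \<Lambda>_def by blast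
    have EF: "E h \<in> F j" "\<kappa> j (E h) = \<kappa> j (\<psi> h)"
      unfolding E_def using inv_tw_F[OF j h(1,2) u] by auto
    have "\<kappa> j (inv (E h) \<otimes> (inv n \<otimes> n')) = 0"
      using \<kappa>_mult[OF j F_inv[OF EF(1)] nn] \<kappa>_inv[OF j EF(1)] \<kappa>nn h(3) EF(2) by simp
    then have "inv (E h) \<otimes> (inv n \<otimes> n') \<in> F (Suc j)"
      using \<kappa>_kernel[OF j F_mult[OF F_inv[OF EF(1)] nn]] by blast
    then show "\<exists>h\<in>H. inv (E h) \<otimes> (inv n \<otimes> n') \<in> F (Suc j)" using h(1) by blast
  qed
  also have "\<dots> \<longleftrightarrow> add_coset (\<Lambda> j) (\<kappa> j n) = add_coset (\<Lambda> j) (\<kappa> j n')"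
    using add_coset_eq_iff[OF add_subgroup_\<Lambda>[OF j], of "\<kappa> j n'" "\<kappa> j n"] by auto
  finally show ?thesis .
qed

section \<open>Counting classes level by level\<close>

text \<open>Every element of the class of \<open>x\<close> at level \<open>j\<close> can be moved by
  the action into the coset of \<open>x\<close> modulo \<open>F j\<close>, so that coset represents
  all finer classes.\<close>

lemma cls_fibre:
  assumes x: "x \<in> carrier G"
  shows "cls (Suc j) ` {y \<in> carrier G. cls j y = cls j x} = (\<lambda>n. cls (Suc j) (x \<otimes> n)) ` F j"
proof (intro equalityI subsetI)
  fix C assume "C \<in> cls (Suc j) ` {y \<in> carrier G. cls j y = cls j x}"
  then obtain y where y: "y \<in> carrier G" "cls j y = cls j x" "C = cls (Suc j) y" by blast
  then have "y \<in> cls j x" using cls_self by metis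
  then obtain h f where h: "h \<in> H" "f \<in> F j" "y = tw h x \<otimes> f"
    by (auto simp: cls_def)
  \<comment> \<open>Conjugation carries \<open>f\<close> past \<open>inv (\<phi> h)\<close>, so that
    \<open>y\<close> becomes the image of \<open>x \<otimes> ?n\<close> under
    \<open>h\<close>.\<close>
  let ?n = "inv (\<phi> h) \<otimes> f \<otimes> inv (inv (\<phi> h))"
  have n: "?n \<in> F j" using h by (intro F_conj) auto
  have "y = tw h (x \<otimes> ?n) \<otimes> \<one>"
    using h(1,3) x F_carrier[OF h(2)] by (simp add: tw_def word_simps)
  then have "y \<in> cls (Suc j) (x \<otimes> ?n)"
    unfolding cls_def using h(1) F_one[of "Suc j"] by blast
  then have "cls (Suc j) (x \<otimes> ?n) = cls (Suc j) y"
    using cls_eq_iff x y(1) F_carrier[OF n] by simp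
  then show "C \<in> (\<lambda>n. cls (Suc j) (x \<otimes> n)) ` F j"
    using n y(3) by blast
next
  fix C assume "C \<in> (\<lambda>n. cls (Suc j) (x \<otimes> n)) ` F j"
  then obtain n where n: "n \<in> F j" "C = cls (Suc j) (x \<otimes> n)" by blast
  have "x \<otimes> n = tw \<one> x \<otimes> n" using x by (simp add: tw_one)
  then have "x \<otimes> n \<in> cls j x" unfolding cls_def using n(1) H.one_closed by blast
  then have "cls j (x \<otimes> n) = cls j x" using cls_eq_iff[of x "x \<otimes> n" j, THEN iffD2] x F_carrier[OF n(1)] by simp
  then show "C \<in> cls (Suc j) ` {y \<in> carrier G. cls j y = cls j x}"
    using n x F_carrier[OF n(1)] by auto
qed

lemma card_cls_fibre:
  assumes j: "j < c" and inj: "\<And>i. i < j \<Longrightarrow> \<psi>_inj i" and x: "x \<in> carrier G"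
  shows "card (cls (Suc j) ` {y \<in> carrier G. cls j y = cls j x}) = card (add_coset (\<Lambda> j) ` zvec (k j))"
    and "finite (cls (Suc j) ` {y \<in> carrier G. cls j y = cls j x}) \<longleftrightarrow> finite (add_coset (\<Lambda> j) ` zvec (k j))"
proof -
  note * = card_image_if_same_fibres[of "F j" "\<lambda>n. cls (Suc j) (x \<otimes> n)" "\<lambda>n. add_coset (\<Lambda> j) (\<kappa> j n)",
      OF cls_Suc_eq_iff[OF j inj x]]
  have **: "add_coset (\<Lambda> j) ` zvec (k j) = (\<lambda>n. add_coset (\<Lambda> j) (\<kappa> j n)) ` F j"
    unfolding \<kappa>_image[OF j, symmetric] image_image ..
  show "card (cls (Suc j) ` {y \<in> carrier G. cls j y = cls j x}) = card (add_coset (\<Lambda> j) ` zvec (k j))"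
    unfolding cls_fibre[OF x] ** by (rule *)
  show "finite (cls (Suc j) ` {y \<in> carrier G. cls j y = cls j x}) \<longleftrightarrow> finite (add_coset (\<Lambda> j) ` zvec (k j))"
    unfolding cls_fibre[OF x] ** by (rule *)
qed

lemma finite_cls_Suc:
  assumes "j < c" "\<And>i. i < j \<Longrightarrow> \<psi>_inj i" "finite (cls j ` carrier G)" "finite (add_coset (\<Lambda> j) ` zvec (k j))"
  shows "finite (cls (Suc j) ` carrier G)"
  by (rule finite_image_refinement[OF assms(3)]) (simp only: card_cls_fibre(2)[OF assms(1,2)] assms(4))

lemma card_cls_Suc:
  assumes "j < c" "\<And>i. i < j \<Longrightarrow> \<psi>_inj i" "finite (cls (Suc j) ` carrier G)"
  shows "card (cls (Suc j) ` carrier G) = card (add_coset (\<Lambda> j) ` zvec (k j)) * card (cls j ` carrier G)"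
  by (rule card_image_refinement[OF assms(3) cls_refine card_cls_fibre(1)[OF assms(1,2)]])

lemma finite_cls_coarser:
  assumes "finite (cls n ` carrier G)" "j \<le> n"
  shows "finite (cls j ` carrier G)"
  using assms(2,1)
proof (induction rule: inc_induct)
  case (step m)
  show ?case by (rule finite_image_coarser[OF step.IH[OF step.prems] cls_refine])
qed

text \<open>The fibre over the class of \<open>\<one>\<close> already has as many elements as there
  are cosets of \<open>\<Lambda> j\<close>. The contrapositive detects infinitely many twisted
  classes in the singular case.\<close>

lemma finite_\<Lambda>:
  assumes j: "j < c" and inj: "\<And>i. i < j \<Longrightarrow> \<psi>_inj i" and fin: "finite (cls (Suc j) ` carrier G)"
  shows "finite (add_coset (\<Lambda> j) ` zvec (k j))"
proof -
  have "finite (cls (Suc j) ` {y \<in> carrier G. cls j y = cls j \<one>})"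
    by (rule finite_subset[OF _ fin]) auto
  then show ?thesis using card_cls_fibre(2)[OF j inj one_closed] by simp
qed

end

section \<open>Coordinates and the product formula\<close>

lemma one_minus_four_block_diag:
  fixes A B :: "'a::ring_1 mat"
  assumes A: "A \<in> carrier_mat n n" and B: "B \<in> carrier_mat m m"
  shows "1\<^sub>m (n + m) - four_block_mat A (0\<^sub>m n m) (0\<^sub>m m n) B
    = four_block_mat (1\<^sub>m n - A) (0\<^sub>m n m) (0\<^sub>m m n) (1\<^sub>m m - B)"
proof (rule eq_matI)
  fix i j assume "i < dim_row (four_block_mat (1\<^sub>m n - A) (0\<^sub>m n m) (0\<^sub>m m n) (1\<^sub>m m - B))"
    "j < dim_col (four_block_mat (1\<^sub>m n - A) (0\<^sub>m n m) (0\<^sub>m m n) (1\<^sub>m m - B))"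
  then have ij: "i < n + m" "j < n + m" using A B by simp_all
  then show "(1\<^sub>m (n + m) - four_block_mat A (0\<^sub>m n m) (0\<^sub>m m n) B) $$ (i, j)
    = four_block_mat (1\<^sub>m n - A) (0\<^sub>m n m) (0\<^sub>m m n) (1\<^sub>m m - B) $$ (i, j)"
    using A B by (cases "i < n"; cases "j < n") auto
qed (use A B in simp_all)

lemma det_one_minus_diag_block_mat:
  fixes As :: "'a::idom mat list"
  assumes "\<And>A. A \<in> set As \<Longrightarrow> square_mat A"
  shows "det (1\<^sub>m (sum_list (map dim_row As)) - diag_block_mat As) = (\<Prod>A\<leftarrow>As. det (1\<^sub>m (dim_row A) - A))"
  using assms
proof (induction As)
  case Nil
  then show ?case by (simp add: det_dim_zero[OF minus_carrier_mat])
next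
  case (Cons A As)
  define n m B where "n = dim_row A" and "m = sum_list (map dim_row As)" and "B = diag_block_mat As"
  have A: "A \<in> carrier_mat n n" using Cons.prems[of A] by (auto simp: n_def)
  have "map dim_col As = map dim_row As" using Cons.prems by (intro map_cong) auto
  then have B: "B \<in> carrier_mat m m"
    unfolding B_def m_def by (intro carrier_matI) (simp_all only: dim_diag_block_mat)
  have "diag_block_mat (A # As) = four_block_mat A (0\<^sub>m n m) (0\<^sub>m m n) B"
    unfolding diag_block_mat.simps Let_def B_def[symmetric] using A B by simp
  then have "det (1\<^sub>m (n + m) - diag_block_mat (A # As))
      = det (four_block_mat (1\<^sub>m n - A) (0\<^sub>m n m) (0\<^sub>m m n) (1\<^sub>m m - B))"
    by (simp only: one_minus_four_block_diag[OF A B])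
  also have "\<dots> = det (1\<^sub>m n - A) * det (1\<^sub>m m - B)"
    by (rule det_four_block_mat_upper_right_zero[OF _ refl]) (use A B in \<open>simp_all add: minus_carrier_mat\<close>)
  also have "det (1\<^sub>m m - B) = (\<Prod>A\<leftarrow>As. det (1\<^sub>m (dim_row A) - A))"
    unfolding m_def B_def by (rule Cons.IH) (use Cons.prems in simp)
  finally show ?case
    by (simp only: list.map sum_list.Cons prod_list.Cons n_def m_def)
qed

lemma twisted_classes_trivial:
  assumes "group G" "subgroup H G"
  shows "twisted_classes G H (\<lambda>_. \<one>\<^bsub>G\<^esub>) = rcosets\<^bsub>G\<^esub> H"
proof -
  interpret group G by fact
  interpret H: subgroup H G by fact
  have "{h \<otimes>\<^bsub>G\<^esub> x \<otimes>\<^bsub>G\<^esub> inv\<^bsub>G\<^esub> \<one>\<^bsub>G\<^esub> |h. h \<in> H} = H #>\<^bsub>G\<^esub> x" if x: "x \<in> carrier G" for x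
  proof -
    have "h \<otimes>\<^bsub>G\<^esub> x \<otimes>\<^bsub>G\<^esub> inv\<^bsub>G\<^esub> \<one>\<^bsub>G\<^esub> = h \<otimes>\<^bsub>G\<^esub> x" if "h \<in> H" for h
      using that x by simp
    then have "{h \<otimes>\<^bsub>G\<^esub> x \<otimes>\<^bsub>G\<^esub> inv\<^bsub>G\<^esub> \<one>\<^bsub>G\<^esub> |h. h \<in> H} = {h \<otimes>\<^bsub>G\<^esub> x |h. h \<in> H}"
      by (intro Collect_cong) metis
    then show ?thesis by (auto simp: r_coset_def)
  qed
  then show ?thesis
    unfolding twisted_classes_def RCOSETS_def by auto
qed

section \<open>Coordinates on a central layer\<close>

lemma (in group) mult_exchange:
  assumes "y \<otimes> z = z \<otimes> y" "x \<in> carrier G" "y \<in> carrier G" "z \<in> carrier G" "w \<in> carrier G"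
  shows "(x \<otimes> y) \<otimes> (z \<otimes> w) = (x \<otimes> z) \<otimes> (y \<otimes> w)"
proof -
  have "y \<otimes> (z \<otimes> w) = z \<otimes> (y \<otimes> w)"
    using assms by (simp add: m_assoc[symmetric])
  then show ?thesis using assms by (simp add: m_assoc)
qed

text \<open>Exponents of \<open>x\<close> modulo \<open>M\<close> in the basis \<open>a\<close>. The
  description is proper for \<open>x\<close> in the subgroup \<open>A\<close> of the locale below,
  by its assumption \<open>free\<close>.\<close>

definition coord :: "('a, 'b) monoid_scheme \<Rightarrow> 'a set \<Rightarrow> (nat \<Rightarrow> 'a) \<Rightarrow> nat \<Rightarrow> 'a \<Rightarrow> nat \<Rightarrow> int" where
  "coord G M a k x = (THE z. (\<forall>j\<ge>k. z j = 0) \<and>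
     inv\<^bsub>G\<^esub> (gprod G (\<lambda>j. a j [^]\<^bsub>G\<^esub> z j) k) \<otimes>\<^bsub>G\<^esub> x \<in> M)"

locale coordinates = group G for G (structure) +
  fixes A M :: "'a set" and a :: "nat \<Rightarrow> 'a" and k :: nat
  assumes A: "subgroup A G" and M: "M \<lhd> G"
    and central: "g \<in> carrier G \<Longrightarrow> x \<in> A \<Longrightarrow> gcomm G g x \<in> M"
    and a_mem: "j < k \<Longrightarrow> a j \<in> A"
    and free: "x \<in> A \<Longrightarrow> \<exists>!z. (\<forall>j\<ge>k. z j = 0) \<and> inv (gprod G (\<lambda>j. a j [^] (z j :: int)) k) \<otimes> x \<in> M"
begin

abbreviation "bp z n \<equiv> gprod G (\<lambda>j. a j [^] (z j :: int)) n"

lemma bp_mem: "n \<le> k \<Longrightarrow> bp z n \<in> A"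
  by (induction n) (auto intro!: subgroup.one_closed[OF A] subgroup.m_closed[OF A] subgroup_int_pow_closed[OF A] a_mem)

lemma coord_spec:
  assumes "x \<in> A"
  shows "coord G M a k x \<in> zvec k" and "inv (bp (coord G M a k x) k) \<otimes> x \<in> M"
  using theI'[OF free[OF assms]] unfolding coord_def zvec_def by blast+

lemma coord_unique:
  assumes "x \<in> A" "z \<in> zvec k" "inv (bp z k) \<otimes> x \<in> M"
  shows "coord G M a k x = z"
  unfolding coord_def by (rule the1_equality[OF free[OF assms(1)]]) (use assms in \<open>auto simp: zvec_def\<close>)

text \<open>By uniqueness it is enough that the basis product with the summed exponents is congruent
  to \<open>x \<otimes> y\<close>. Modulo \<open>M\<close> the elements of \<open>A\<close> are
  central, so the factors can be rearranged, by induction on their number.\<close>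

lemma coord_hom:
  assumes x: "x \<in> A" and y: "y \<in> A"
  shows "coord G M a k (x \<otimes> y) = coord G M a k x + coord G M a k y"
proof (rule coord_unique)
  show "x \<otimes> y \<in> A" using subgroup.m_closed[OF A x y] .
  let ?z = "coord G M a k x" and ?w = "coord G M a k y"
  show "?z + ?w \<in> zvec k"
    using add_subgroup_add[OF add_subgroup_zvec] coord_spec x y by blast
  obtain Q :: "'a set monoid" and p where p: "group_hom G Q p"
    and p_eq: "\<And>x y. x \<in> carrier G \<Longrightarrow> y \<in> carrier G \<Longrightarrow> p x = p y \<longleftrightarrow> inv x \<otimes> y \<in> M"
    using quotient_map[OF M] by metis
  interpret p: group_hom G Q p by fact
  have Ac: "u \<in> carrier G" if "u \<in> A" for u using subgroup.subset[OF A] that by blast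
  have comm: "p u \<otimes>\<^bsub>Q\<^esub> p g = p g \<otimes>\<^bsub>Q\<^esub> p u" if "u \<in> A" "g \<in> carrier G" for u g
    by (rule quotient_commute[OF p p_eq Ac[OF that(1)] that(2)])
      (use that central[of "inv g" "inv u"] subgroup.m_inv_closed[OF A] in auto)
  have "p (bp (?z + ?w) n) = p (bp ?z n) \<otimes>\<^bsub>Q\<^esub> p (bp ?w n)" if "n \<le> k" for n
    using that
  proof (induction n)
    case (Suc n)
    let ?u = "bp ?z n" and ?v = "bp ?w n"
    have u: "?u \<in> A" and v: "?v \<in> A" and zw: "bp (?z + ?w) n \<in> A"
      using Suc.prems by (auto intro!: bp_mem)
    have an: "a n \<in> A" using a_mem Suc.prems by auto
    let ?s = "a n [^] ?z n" and ?t = "a n [^] ?w n"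
    have s: "?s \<in> A" and t: "?t \<in> A" using subgroup_int_pow_closed[OF A an] by auto
    have "p (bp (?z + ?w) (Suc n)) = p (bp (?z + ?w) n) \<otimes>\<^bsub>Q\<^esub> p (a n [^] (?z n + ?w n))"
      using Ac[OF zw] Ac[OF an] by simp
    also have "\<dots> = (p ?u \<otimes>\<^bsub>Q\<^esub> p ?v) \<otimes>\<^bsub>Q\<^esub> (p ?s \<otimes>\<^bsub>Q\<^esub> p ?t)"
      using Suc.IH Suc.prems Ac[OF an] int_pow_mult[OF Ac[OF an], of "?z n" "?w n"] by simp
    also have "\<dots> = (p ?u \<otimes>\<^bsub>Q\<^esub> p ?s) \<otimes>\<^bsub>Q\<^esub> (p ?v \<otimes>\<^bsub>Q\<^esub> p ?t)"
      by (rule p.H.mult_exchange[OF comm[OF v Ac[OF s]]]) (use Ac u v s t in simp_all)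
    also have "\<dots> = p (bp ?z (Suc n)) \<otimes>\<^bsub>Q\<^esub> p (bp ?w (Suc n))"
      using Ac[OF s] Ac[OF t] Ac[OF v] Ac[OF u] by simp
    finally show ?case .
  qed simp
  then have "p (bp (?z + ?w) k) = p (bp ?z k) \<otimes>\<^bsub>Q\<^esub> p (bp ?w k)" by simp
  also have "p (bp ?z k) = p x"
    using coord_spec(2)[OF x] p_eq[OF Ac[OF bp_mem] Ac[OF x]] by simp
  also have "p (bp ?w k) = p y"
    using coord_spec(2)[OF y] p_eq[OF Ac[OF bp_mem] Ac[OF y]] by simp
  also have "p x \<otimes>\<^bsub>Q\<^esub> p y = p (x \<otimes> y)"
    using Ac[OF x] Ac[OF y] by simp
  finally show "inv (bp (?z + ?w) k) \<otimes> (x \<otimes> y) \<in> M"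
    using p_eq[OF Ac[OF bp_mem], of k "x \<otimes> y" "?z + ?w"] Ac[OF x] Ac[OF y] by simp
qed

lemma coord_image: "coord G M a k ` A = zvec k"
proof (intro equalityI subsetI)
  fix z assume z: "z \<in> zvec k"
  have b: "bp z k \<in> A" by (rule bp_mem) simp
  have "inv (bp z k) \<otimes> bp z k \<in> M"
    using subgroup.subset[OF A] b subgroup.one_closed[OF normal_imp_subgroup[OF M]] by (simp add: subsetD)
  then have "coord G M a k (bp z k) = z" by (rule coord_unique[OF b z])
  then show "z \<in> coord G M a k ` A" using imageI[OF b, of "coord G M a k"] by simp
qed (auto intro: coord_spec)

lemma bp_zero: "bp 0 n = \<one>"
  by (induction n) auto

lemma coord_zero_iff:
  assumes x: "x \<in> A"
  shows "coord G M a k x = 0 \<longleftrightarrow> x \<in> M"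
proof -
  have xc: "x \<in> carrier G" using subgroup.subset[OF A] x by blast
  have "inv (bp 0 k) \<otimes> x = x" using xc bp_zero[of k] by simp
  then show ?thesis
    using coord_spec(2)[OF x] coord_unique[OF x add_subgroup_zero[OF add_subgroup_zvec]] by metis
qed

end

section \<open>Assembly of the product formula\<close>

theorem mainTheorem3:
  fixes G :: "('a, 'b) monoid_scheme"
    and H :: "'a set"
    and \<phi> :: "'a \<Rightarrow> 'a"
    and c :: nat
    and k :: "nat \<Rightarrow> nat"
    and a :: "nat \<Rightarrow> nat \<Rightarrow> 'a"
    and Mi :: "nat \<Rightarrow> rat mat"
  defines "NN \<equiv> (\<lambda>i. isolator G (lcs G i))"
    and "HH \<equiv> (\<lambda>i. isolator (G\<lparr>carrier := H\<rparr>) (lcs (G\<lparr>carrier := H\<rparr>) i))"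
    and "bprod \<equiv> (\<lambda>i (z :: nat \<Rightarrow> int). gprod G (\<lambda>j. a i j [^]\<^bsub>G\<^esub> z j) (k i))"
  assumes grp: "group G"
    and fg: "finitely_generated_group G"
    and tf: "torsion_free G"
    and cls: "nilpotent_class G c"
    and sub: "subgroup H G"
    and fin_index: "finite (rcosets\<^bsub>G\<^esub> H)"
    and hom: "\<phi> \<in> hom (G\<lparr>carrier := H\<rparr>) G"
    and basis_mem: "\<And>i j. i \<in> {1..c} \<Longrightarrow> j < k i \<Longrightarrow> a i j \<in> NN i"
    and basis_free: "\<And>i x. i \<in> {1..c} \<Longrightarrow> x \<in> NN i \<Longrightarrow>
        \<exists>!z. (\<forall>j \<ge> k i. z j = 0) \<and> inv\<^bsub>G\<^esub> (bprod i z) \<otimes>\<^bsub>G\<^esub> x \<in> NN (i + 1)"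
    and Mi_dim: "\<And>i. i \<in> {1..c} \<Longrightarrow> Mi i \<in> carrier_mat (k i) (k i)"
    and Mi_def: "\<And>i h z w. i \<in> {1..c} \<Longrightarrow> h \<in> HH i \<Longrightarrow>
        (\<forall>j \<ge> k i. z j = 0) \<Longrightarrow> (\<forall>j \<ge> k i. w j = 0) \<Longrightarrow>
        inv\<^bsub>G\<^esub> (bprod i z) \<otimes>\<^bsub>G\<^esub> h \<in> NN (i + 1) \<Longrightarrow>
        inv\<^bsub>G\<^esub> (bprod i w) \<otimes>\<^bsub>G\<^esub> \<phi> h \<in> NN (i + 1) \<Longrightarrow>
        vec (k i) (\<lambda>j. rat_of_int (w j)) = Mi i *\<^sub>v vec (k i) (\<lambda>j. rat_of_int (z j))"
  shows "ereal_of_enat (reidemeister G H \<phi>) =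
    ereal (real (card (rcosets\<^bsub>G\<^esub> H))) *
    abs_inf (real_of_rat (det (1\<^sub>m (\<Sum>i\<in>{1..c}. k i) - diag_block_mat (map Mi [1..<c + 1]))))"
proof -
  interpret group G by (rule grp)
  \<comment> \<open>Everything is shifted to indices from 0, so layer \<open>j\<close> of the
    filtration belongs to \<open>i = Suc j\<close> in the statement.\<close>
  define F where "F j = isolator G (lcs0 G j)" for j
  define k' where "k' j = k (Suc j)" for j
  define \<kappa> where "\<kappa> j = coord G (F (Suc j)) (a (Suc j)) (k' j)" for j
  have nil: "lcs0 G c = {\<one>\<^bsub>G\<^esub>}"
    using cls by (simp add: nilpotent_class_def lcs_def)
  have NN: "NN (Suc j) = F j" for j
    by (simp add: NN_def F_def lcs_def)
  have pow: "\<exists>m::nat>0. x [^]\<^bsub>G\<^esub> m \<in> H" if "x \<in> carrier G" for x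
    by (rule finite_index_power_mem[OF sub fin_index that])
  have HH: "HH (Suc j) = H \<inter> F j" for j
    unfolding HH_def lcs_def F_def using isolator_lcs0_subgroup[OF nil sub pow, of j] by simp
  have F_normal: "F j \<lhd> G" for j
    unfolding F_def by (rule isolator_normal[OF nil lcs0_normal])
  have F_0: "F 0 = carrier G"
    unfolding F_def using isolator_subset[of "carrier G"] by (auto simp: isolator_iff)
  have F_c: "F c = {\<one>\<^bsub>G\<^esub>}"
  proof
    show "F c \<subseteq> {\<one>\<^bsub>G\<^esub>}"
    proof
      fix x assume "x \<in> F c"
      then obtain m :: nat where "x \<in> carrier G" "m > 0" "x [^]\<^bsub>G\<^esub> m = \<one>\<^bsub>G\<^esub>"
        unfolding F_def nil isolator_iff by blast
      then show "x \<in> {\<one>\<^bsub>G\<^esub>}" using tf unfolding torsion_free_def by blast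
    qed
    show "{\<one>\<^bsub>G\<^esub>} \<subseteq> F c"
      unfolding F_def nil by (rule isolator_subset) simp
  qed
  have F_Suc: "F (Suc j) \<subseteq> F j" for j
    unfolding F_def by (rule isolator_mono[OF lcs0_antimono]) simp
  have F_central: "gcomm G g x \<in> F (Suc j)" if "g \<in> carrier G" "x \<in> F j" for g x j
    using gcomm_in_isolator_lcs0_Suc[OF nil that(1)] that(2) unfolding F_def by blast
  have coords: "coordinates G (F j) (F (Suc j)) (a (Suc j)) (k' j)" if j: "j < c" for j
  proof (rule coordinates.intro[OF grp], rule coordinates_axioms.intro)
    show "a (Suc j) i \<in> F j" if "i < k' j" for i
      using basis_mem[of "Suc j" i] j that by (simp add: NN k'_def)
    show "\<exists>!z. (\<forall>i\<ge>k' j. z i = 0) \<and>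
        inv\<^bsub>G\<^esub> gprod G (\<lambda>i. a (Suc j) i [^]\<^bsub>G\<^esub> (z i :: int)) (k' j) \<otimes>\<^bsub>G\<^esub> x \<in> F (Suc j)"
      if "x \<in> F j" for x
      using basis_free[of "Suc j" x] j that by (simp add: NN k'_def bprod_def)
  qed (fact normal_imp_subgroup[OF F_normal] F_normal F_central)+
  have \<kappa>_mult: "\<kappa> j (x \<otimes>\<^bsub>G\<^esub> y) = \<kappa> j x + \<kappa> j y" if "j < c" "x \<in> F j" "y \<in> F j" for j x y
    unfolding \<kappa>_def by (rule coordinates.coord_hom[OF coords[OF that(1)] that(2,3)])
  have \<kappa>_image: "\<kappa> j ` F j = zvec (k' j)" if "j < c" for j
    unfolding \<kappa>_def by (rule coordinates.coord_image[OF coords[OF that]])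
  have \<kappa>_kernel: "\<kappa> j x = 0 \<longleftrightarrow> x \<in> F (Suc j)" if "j < c" "x \<in> F j" for j x
    unfolding \<kappa>_def by (rule coordinates.coord_zero_iff[OF coords[OF that(1)] that(2)])
  have \<phi>_F: "\<phi> h \<in> F j" if "h \<in> H" "h \<in> F j" for h j
    using hom_isolator_lcs0[OF sub hom, of h j] isolator_lcs0_subgroup[OF nil sub pow, of j] that
    unfolding F_def by blast
  have "twisted_filtration G F c k' \<kappa> H \<phi>"
    by (rule twisted_filtration.intro[OF grp], rule twisted_filtration_axioms.intro)
      (fact F_normal F_0 F_c F_Suc F_central \<kappa>_mult \<kappa>_image \<kappa>_kernel sub hom \<phi>_F)+
  then interpret T: twisted_filtration G F c k' \<kappa> H \<phi> .
  \<comment> \<open>The comparison instance: here \<open>\<psi>\<close> is the identity on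
    \<open>H\<close>, injectivity is automatic, and the classes at level \<open>c\<close> are the
    cosets of \<open>H\<close>.\<close>
  interpret E: twisted_filtration G F c k' \<kappa> H "\<lambda>_. \<one>\<^bsub>G\<^esub>"
    by (rule T.trivial_twisted_filtration)
  have E_\<psi>: "E.\<psi> h = h" if "h \<in> H" for h
    using that by (simp add: E.\<psi>_def)
  have E_\<Lambda>: "E.\<Lambda> j = \<kappa> j ` (H \<inter> F j)" for j
    unfolding E.\<Lambda>_def by (rule image_cong) (auto simp: E_\<psi>)
  have E_inj: "E.\<psi>_inj j" for j
    unfolding E.\<psi>_inj_def by (auto simp: E_\<psi>)
  have E_index: "E.cls c ` carrier G = rcosets\<^bsub>G\<^esub> H"
    unfolding E.cls_c_image by (rule twisted_classes_trivial[OF grp sub])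
  have E_finite: "finite (E.cls j ` carrier G)" if "j \<le> c" for j
    by (rule E.finite_cls_coarser[OF _ that]) (simp add: E_index fin_index)
  have E_finite_\<Lambda>: "finite (add_coset (E.\<Lambda> j) ` zvec (k' j))" if "j < c" for j
    by (rule E.finite_\<Lambda>[OF that E_inj E_finite]) (use that in simp)
  define D where "D j = 1\<^sub>m (k' j) - Mi (Suc j)" for j
  have Mi: "Mi (Suc j) \<in> carrier_mat (k' j) (k' j)" if "j < c" for j
    using Mi_dim[of "Suc j"] that by (simp add: k'_def)
  have D: "D j \<in> carrier_mat (k' j) (k' j)" if "j < c" for j
    using Mi[OF that] by (simp add: D_def minus_carrier_mat)
  have \<kappa>_zvec: "\<kappa> j x \<in> zvec (k' j)" if "j < c" "x \<in> F j" for j x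
    using \<kappa>_image[OF that(1)] that(2) by blast
  have \<kappa>_spec: "inv\<^bsub>G\<^esub> (bprod (Suc j) (\<kappa> j x)) \<otimes>\<^bsub>G\<^esub> x \<in> NN (Suc j + 1)" if "j < c" "x \<in> F j" for j x
    using coordinates.coord_spec(2)[OF coords[OF that(1)] that(2)] NN[of "Suc j"]
    by (simp add: bprod_def \<kappa>_def k'_def)
  \<comment> \<open>\<open>Mi_def\<close> is instantiated with the coordinates of \<open>h\<close>
    and of \<open>\<phi> h\<close> as exponent vectors.\<close>
  have \<kappa>_\<phi>: "rat_of_int (\<kappa> j (\<phi> h) i) = mat_app (Mi (Suc j)) (\<lambda>l. rat_of_int (\<kappa> j h l)) i"
    if j: "j < c" and h: "h \<in> H" "h \<in> F j" and i: "i < k' j" for j h i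
  proof -
    have "vec (k (Suc j)) (\<lambda>l. rat_of_int (\<kappa> j (\<phi> h) l))
        = Mi (Suc j) *\<^sub>v vec (k (Suc j)) (\<lambda>l. rat_of_int (\<kappa> j h l))"
    proof (rule Mi_def)
      show "\<forall>l\<ge>k (Suc j). \<kappa> j h l = 0" "\<forall>l\<ge>k (Suc j). \<kappa> j (\<phi> h) l = 0"
        using \<kappa>_zvec[OF j h(2)] \<kappa>_zvec[OF j \<phi>_F[OF h]] by (simp_all add: zvec_def k'_def)
    qed (use j h HH[of j] \<kappa>_spec[OF j h(2)] \<kappa>_spec[OF j \<phi>_F[OF h]] in auto)
    then show ?thesis
      using i mat_app_mult_mat_vec[OF Mi[OF j] i] unfolding k'_def by (metis index_vec)
  qed
  have \<kappa>_\<psi>: "rat_of_int (\<kappa> j (T.\<psi> h) i) = mat_app (D j) (\<lambda>l. rat_of_int (\<kappa> j h l)) i"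
    if j: "j < c" and h: "h \<in> H" "h \<in> F j" and i: "i < k' j" for j h i
  proof -
    let ?z = "\<lambda>l. rat_of_int (\<kappa> j h l)"
    have "mat_app (D j) ?z i = (\<Sum>l<k' j. (if l = i then ?z i else 0) - Mi (Suc j) $$ (i, l) * ?z l)"
      using D[OF j] Mi[OF j] i by (auto simp: mat_app_def D_def algebra_simps intro!: sum.cong)
    also have "\<dots> = ?z i - mat_app (Mi (Suc j)) ?z i"
      using Mi[OF j] i by (simp add: mat_app_def sum_subtractf)
    finally show ?thesis
      using T.\<kappa>_\<psi>[OF j h] \<kappa>_\<phi>[OF j h i] by simp
  qed
  \<comment> \<open>The floor only turns rationals into integers: on the lattice
    \<open>E.\<Lambda> j\<close> the values are integral by \<open>\<kappa>_\<psi>\<close>, so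
    nothing is rounded there.\<close>
  define \<theta> where "\<theta> j z = (\<lambda>i. \<lfloor>mat_app (D j) (\<lambda>l. rat_of_int (z l)) i\<rfloor>)" for j and z :: "nat \<Rightarrow> int"
  have \<theta>: "\<theta> j (\<kappa> j h) = \<kappa> j (T.\<psi> h)" if j: "j < c" and h: "h \<in> H" "h \<in> F j" for j h
  proof
    fix i
    show "\<theta> j (\<kappa> j h) i = \<kappa> j (T.\<psi> h) i"
    proof (cases "i < k' j")
      case True
      then show ?thesis unfolding \<theta>_def \<kappa>_\<psi>[OF j h True, symmetric] by simp
    next
      case False
      then show ?thesis
        using \<kappa>_zvec[OF j T.\<psi>_F[OF h]] D[OF j] by (simp add: \<theta>_def mat_app_def zvec_def)
    qed
  qed
  have T_\<Lambda>: "T.\<Lambda> j = \<theta> j ` E.\<Lambda> j" if j: "j < c" for j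
    unfolding T.\<Lambda>_def E_\<Lambda> image_image by (rule image_cong) (auto simp: \<theta>[OF j])
  have E_\<Lambda>_zvec: "E.\<Lambda> j \<subseteq> zvec (k' j)" if "j < c" for j
    unfolding E_\<Lambda> using \<kappa>_zvec[OF that] by blast
  have T_inj: "T.\<psi>_inj j" if j: "j < c" and det: "det (D j) \<noteq> 0" for j
    unfolding T.\<psi>_inj_def
  proof (intro ballI impI)
    fix h assume h: "h \<in> H \<inter> F j" "T.\<psi> h \<in> F (Suc j)"
    have "\<kappa> j (T.\<psi> h) = 0" using \<kappa>_kernel[OF j T.\<psi>_F] h by blast
    have "\<kappa> j h i = 0" for i
    proof (cases "i < k' j")
      case True
      have "rat_of_int (\<kappa> j h i) = 0"
      proof (rule mat_app_eq_zero_imp[OF D[OF j] det _ True])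
        show "mat_app (D j) (\<lambda>l. rat_of_int (\<kappa> j h l)) i' = 0" if "i' < k' j" for i'
          using \<kappa>_\<psi>[OF j _ _ that, of h] h(1) \<open>\<kappa> j (T.\<psi> h) = 0\<close> by simp
      qed
      then show ?thesis by simp
    next
      case False
      then show ?thesis using \<kappa>_zvec[OF j] h by (auto simp: zvec_def)
    qed
    then have "\<kappa> j h = 0" by (simp add: fun_eq_iff)
    then show "h \<in> F (Suc j)" using \<kappa>_kernel[OF j] h by blast
  qed
  have T_index: "finite (add_coset (T.\<Lambda> j) ` zvec (k' j))"
    "rat_of_nat (card (add_coset (T.\<Lambda> j) ` zvec (k' j)))
      = \<bar>det (D j)\<bar> * rat_of_nat (card (add_coset (E.\<Lambda> j) ` zvec (k' j)))"
    if j: "j < c" and det: "det (D j) \<noteq> 0" for j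
  proof -
    have 1: "\<theta> j z \<in> zvec (k' j)" if "z \<in> E.\<Lambda> j" for z
      using that \<kappa>_zvec[OF j T.\<psi>_F] unfolding E_\<Lambda> by (auto simp: \<theta>[OF j])
    have 2: "rat_of_int (\<theta> j z i) = mat_app (D j) (\<lambda>l. rat_of_int (z l)) i"
      if "z \<in> E.\<Lambda> j" "i < k' j" for z i
      using that(1) \<kappa>_\<psi>[OF j _ _ that(2)] unfolding E_\<Lambda> by (auto simp: \<theta>[OF j])
    note * = card_add_coset_rational_image[OF D[OF j] det E.add_subgroup_\<Lambda>[OF j] E_\<Lambda>_zvec[OF j] E_finite_\<Lambda>[OF j] 1 2]
    show "finite (add_coset (T.\<Lambda> j) ` zvec (k' j))"
      unfolding T_\<Lambda>[OF j] by (rule *(1))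
    show "rat_of_nat (card (add_coset (T.\<Lambda> j) ` zvec (k' j)))
      = \<bar>det (D j)\<bar> * rat_of_nat (card (add_coset (E.\<Lambda> j) ` zvec (k' j)))"
      unfolding T_\<Lambda>[OF j] by (rule *(2))
  qed
  \<comment> \<open>Positivity matters in the singular case, because zero times infinity is zero in
    \<open>ereal\<close>.\<close>
  have card_rcosets: "card (rcosets\<^bsub>G\<^esub> H) > 0"
    using fin_index subgroup.subgroup_in_rcosets[OF sub grp] card_gt_0_iff by blast
  have dim: "dim_row (Mi i) = k i" "square_mat (Mi i)" if "i \<in> set [1..<c + 1]" for i
    using Mi_dim[of i] that by auto
  have "map dim_row (map Mi [1..<c + 1]) = map k [1..<c + 1]"
    unfolding map_map by (rule map_cong) (simp_all only: dim comp_def)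
  then have "(\<Sum>i\<in>{1..c}. k i) = sum_list (map dim_row (map Mi [1..<c + 1]))"
    by (simp only: sum_list_distinct_conv_sum_set distinct_upt set_upt) (simp add: atLeastLessThanSuc_atLeastAtMost)
  then have "det (1\<^sub>m (\<Sum>i\<in>{1..c}. k i) - diag_block_mat (map Mi [1..<c + 1]))
      = (\<Prod>A\<leftarrow>map Mi [1..<c + 1]. det (1\<^sub>m (dim_row A) - A))"
    by (simp only:) (rule det_one_minus_diag_block_mat, use dim(2) in \<open>simp only: set_map, blast\<close>)
  also have "\<dots> = (\<Prod>i\<in>{1..<c + 1}. det (1\<^sub>m (dim_row (Mi i)) - Mi i))"
    unfolding map_map comp_def by (subst prod.distinct_set_conv_list[symmetric]) (auto simp del: upt_Suc)
  also have "\<dots> = (\<Prod>j<c. det (D j))"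
    by (rule prod.reindex_bij_witness[of _ Suc "\<lambda>i. i - 1"]) (auto simp: D_def k'_def dim(1) simp del: upt_Suc)
  finally have det_eq: "det (1\<^sub>m (\<Sum>i\<in>{1..c}. k i) - diag_block_mat (map Mi [1..<c + 1])) = (\<Prod>j<c. det (D j))" .
  show ?thesis
  proof (cases "\<forall>j<c. det (D j) \<noteq> 0")
    case True
    \<comment> \<open>The counts for \<open>\<phi>\<close> and for the trivial map are compared at
      every level: passing to the next one multiplies their ratio by the absolute value of
      \<open>det (D j)\<close>. At level \<open>c\<close> the second count is the index of
      \<open>H\<close>.\<close>
    have "finite (T.cls j ` carrier G) \<and>
        rat_of_nat (card (T.cls j ` carrier G)) = \<bar>\<Prod>i<j. det (D i)\<bar> * rat_of_nat (card (E.cls j ` carrier G))"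
      if "j \<le> c" for j
      using that
    proof (induction j)
      case 0
      then show ?case by (simp add: T.cls_0_image E.cls_0_image)
    next
      case (Suc j)
      then have j: "j < c" by simp
      have inj: "T.\<psi>_inj i" if "i < j" for i using T_inj True that j by simp
      have det: "det (D j) \<noteq> 0" using True j by simp
      have IH: "finite (T.cls j ` carrier G)"
        "rat_of_nat (card (T.cls j ` carrier G)) = \<bar>\<Prod>i<j. det (D i)\<bar> * rat_of_nat (card (E.cls j ` carrier G))"
        using Suc.IH j by auto
      have fin: "finite (T.cls (Suc j) ` carrier G)"
        by (rule T.finite_cls_Suc[OF j inj IH(1) T_index(1)[OF j det]])
      have "card (T.cls (Suc j) ` carrier G) = card (add_coset (T.\<Lambda> j) ` zvec (k' j)) * card (T.cls j ` carrier G)"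
        by (rule T.card_cls_Suc[OF j inj fin])
      moreover have "card (E.cls (Suc j) ` carrier G) = card (add_coset (E.\<Lambda> j) ` zvec (k' j)) * card (E.cls j ` carrier G)"
        by (rule E.card_cls_Suc[OF j E_inj E_finite[OF Suc.prems]])
      ultimately have "rat_of_nat (card (T.cls (Suc j) ` carrier G))
          = \<bar>\<Prod>i<Suc j. det (D i)\<bar> * rat_of_nat (card (E.cls (Suc j) ` carrier G))"
        using T_index(2)[OF j det] IH(2) by (simp add: abs_mult)
      then show ?case using fin by blast
    qed
    from this[of c] have fin: "finite (twisted_classes G H \<phi>)"
      and card: "rat_of_nat (card (twisted_classes G H \<phi>)) = \<bar>\<Prod>j<c. det (D j)\<bar> * rat_of_nat (card (rcosets\<^bsub>G\<^esub> H))"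
      by (auto simp: T.cls_c_image E_index)
    have "real (card (twisted_classes G H \<phi>)) = real_of_rat (\<bar>\<Prod>j<c. det (D j)\<bar> * rat_of_nat (card (rcosets\<^bsub>G\<^esub> H)))"
      unfolding card[symmetric] by simp
    also have "\<dots> = real (card (rcosets\<^bsub>G\<^esub> H)) * \<bar>real_of_rat (\<Prod>j<c. det (D j))\<bar>"
      by (simp add: of_rat_mult)
    finally show ?thesis
      unfolding det_eq using True fin by (simp add: reidemeister_def abs_inf_def)
  next
    case False
    \<comment> \<open>Taking the first singular layer ensures \<open>T.\<psi>_inj\<close> on all
      earlier ones, which the description of the fibres at level \<open>j\<close> requires.\<close>
    define j where "j = (LEAST j. j < c \<and> det (D j) = 0)"
    have j: "j < c" "det (D j) = 0"
      using False LeastI_ex[of "\<lambda>j. j < c \<and> det (D j) = 0"] unfolding j_def by auto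
    have inj: "T.\<psi>_inj i" if "i < j" for i
      using T_inj[of i] not_less_Least[of i "\<lambda>j. j < c \<and> det (D j) = 0"] that j(1) unfolding j_def by auto
    have "infinite (add_coset (T.\<Lambda> j) ` zvec (k' j))"
    proof (rule infinite_add_coset_singular[OF D[OF j(1)] j(2) T.add_subgroup_\<Lambda>[OF j(1)]])
      fix v assume "v \<in> T.\<Lambda> j"
      then obtain h where h: "h \<in> H" "h \<in> F j" "v = \<kappa> j (T.\<psi> h)"
        unfolding T.\<Lambda>_def by blast
      then show "\<exists>z. \<forall>i<k' j. rat_of_int (v i) = mat_app (D j) z i"
        using \<kappa>_\<psi>[OF j(1) h(1,2)] by blast
    qed
    then have "infinite (T.cls (Suc j) ` carrier G)"
      using T.finite_\<Lambda>[OF j(1) inj] by blast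
    then have "infinite (twisted_classes G H \<phi>)"
      using T.finite_cls_coarser[of c "Suc j"] j(1) by (auto simp: T.cls_c_image)
    moreover have "(\<Prod>j<c. det (D j)) = 0"
      using j by auto
    ultimately show ?thesis
      unfolding det_eq using card_rcosets by (simp add: reidemeister_def abs_inf_def)
  qed
qed

end
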